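(* For symplectic $\mathbb{C}^*$-manifolds $(Y,\omega,I,\varphi)$ over a convex base, a maximum principle holds on $Y^{\mathrm{out}}$ for the PDEs used in Gromov–Witten theory and in Floer theory, provided one uses the almost complex structure $I$ and the Hamiltonian vector field on $Y^{\mathrm{out}}$ is a positive constant multiple of $X_{S^1}$.
   Context: A symplectic $\mathbb{C}^*$-manifold $(Y,\omega,I,\varphi)$ is a connected symplectic manifold $(Y,\omega)$ with an $\omega$-compatible almost complex structure $I$ and an $I$-pseudoholomorphic $\mathbb{C}^*$-action $\varphi$ whose $S^1$-part is Hamiltonian, with moment map $H:Y\to\mathbb{R}$; $X_{S^1}=X_H$ is the vector field of the $1$-periodic action of $S^1=\mathbb{R}/\mathbb{Z}$, $s\mapsto e^{2\pi i s}\in\mathbb{C}^*$, with the convention $\omega(\cdot,X_H)=dH$. It is *over a convex base* if there is a compact subdomain $Y^{\mathrm{in}}\subset Y$ such that on $Y^{\mathrm{out}}:=Y\setminus\mathrm{int}(Y^{\mathrm{in}})$ there is a proper $(I,I_B)$-pseudoholomorphic map $\Psi:Y^{\mathrm{out}}\to B^{\mathrm{out}}=\Sigma\times[R_0,\infty)$, where $R_0\in\mathbb{R}$ is a constant, $(\Sigma,\alpha)$ is a closed contact manifold, $R$ is the coordinate on $[R_0,\infty)$, $B^{\mathrm{out}}$ carries the symplectic form $d(R\alpha)$ and a $d(R\alpha)$-compatible almost complex structure $I_B$ of contact type (that is, $dR=R\alpha\circ I_B$) and is geometrically bounded at infinity, such that $\Psi_*X_{S^1}=X_{fR}$ (the Hamiltonian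 vector field of the function $fR$ on $B^{\mathrm{out}}$) for some function $f:\Sigma\to(0,\infty)$ invariant under the Reeb flow. For $f\equiv 1$, $X_R$ is the Reeb vector field. The PDEs in question are the pseudoholomorphic curve equation (Gromov–Witten theory) and Floer's equation, which in a local holomorphic coordinate $s+it$ on the domain of a map $u$ into $Y$ reads $\partial_s u+I(\partial_t u-X)=0$, where $X$ is the Hamiltonian vector field used. *)

theory Defs
  imports "HOL-Complex_Analysis.Complex_Analysis"
begin

section \<open>Smooth functions on subsets of Euclidean spaces\<close>

primrec Ck_on :: "nat \<Rightarrow> 'a::euclidean_space set \<Rightarrow> ('a \<Rightarrow> 'b::euclidean_space) \<Rightarrow> bool" where
  "Ck_on 0 S f \<longleftrightarrow> continuous_on S f"
| "Ck_on (Suc k) S f \<longleftrightarrow>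
     (\<forall>x\<in>S. f differentiable at x) \<and> (\<forall>v. Ck_on k S (\<lambda>x. frechet_derivative f (at x) v))"

text \<open>On a set that need not be open, smoothness means local extendability to a smooth function
  on an open set; this covers manifolds with boundary.\<close>

definition smooth_on :: "'a::euclidean_space set \<Rightarrow> ('a \<Rightarrow> 'b::euclidean_space) \<Rightarrow> bool" where
  "smooth_on S f \<longleftrightarrow>
     (\<forall>x\<in>S. \<exists>N g. open N \<and> x \<in> N \<and> (\<forall>k. Ck_on k N g) \<and> (\<forall>y\<in>N \<inter> S. g y = f y))"


section \<open>Manifolds and tensor fields\<close>

text \<open>A manifold is the underlying topological space \<^typ>\<open>'m\<close> of a type together with an
  atlas indexed by \<^typ>\<open>'i\<close>. Indexing the charts lets the product of the manifold with a vector
  space use the same index type.\<close>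

type_synonym ('i, 'm, 'e) atlas = "'i \<Rightarrow> 'm set \<times> ('m \<Rightarrow> 'e)"

abbreviation dom_of :: "('i, 'm, 'e) atlas \<Rightarrow> 'i \<Rightarrow> 'm set" where
  "dom_of A i \<equiv> fst (A i)"

abbreviation crd :: "('i, 'm, 'e) atlas \<Rightarrow> 'i \<Rightarrow> 'm \<Rightarrow> 'e" where
  "crd A i \<equiv> snd (A i)"

definition par :: "('i, 'm, 'e) atlas \<Rightarrow> 'i \<Rightarrow> 'e \<Rightarrow> 'm" where
  "par A i = inv_into (dom_of A i) (crd A i)"

definition topological_chart :: "'m::topological_space set \<Rightarrow> ('m \<Rightarrow> 'e::euclidean_space) \<Rightarrow> bool" where
  "topological_chart V \<psi> \<longleftrightarrow>
     open V \<and> open (\<psi> ` V) \<and> homeomorphism V (\<psi> ` V) \<psi> (inv_into V \<psi>)"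

definition smooth_chart ::
  "('i, 'm::topological_space, 'e::euclidean_space) atlas \<Rightarrow> 'm set \<Rightarrow> ('m \<Rightarrow> 'e) \<Rightarrow> bool" where
  "smooth_chart A V \<psi> \<longleftrightarrow> topological_chart V \<psi> \<and>
     (\<forall>i. smooth_on (\<psi> ` (V \<inter> dom_of A i)) (\<lambda>x. crd A i (inv_into V \<psi> x)) \<and>
          smooth_on (crd A i ` (V \<inter> dom_of A i)) (\<lambda>x. \<psi> (par A i x)))"

definition smooth_atlas :: "('i, 'm::topological_space, 'e::euclidean_space) atlas \<Rightarrow> bool" where
  "smooth_atlas A \<longleftrightarrow> (\<Union>i. dom_of A i) = UNIV \<and> (\<forall>i. smooth_chart A (dom_of A i) (crd A i))"

definition holomorphic_chart ::
  "('k, 's::topological_space, complex) atlas \<Rightarrow> 's set \<Rightarrow> ('s \<Rightarrow> complex) \<Rightarrow> bool" where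
  "holomorphic_chart C V \<zeta> \<longleftrightarrow> topological_chart V \<zeta> \<and>
     (\<forall>k. (\<lambda>x. crd C k (inv_into V \<zeta> x)) holomorphic_on \<zeta> ` (V \<inter> dom_of C k) \<and>
          (\<lambda>x. \<zeta> (par C k x)) holomorphic_on crd C k ` (V \<inter> dom_of C k))"

definition riemann_surface :: "('k, 's::topological_space, complex) atlas \<Rightarrow> bool" where
  "riemann_surface C \<longleftrightarrow>
     (\<Union>k. dom_of C k) = UNIV \<and> (\<forall>k. holomorphic_chart C (dom_of C k) (crd C k))"

text \<open>The product manifold of a manifold with a vector space.\<close>

definition times_vec ::
  "('i, 'm, 'e) atlas \<Rightarrow> ('i, 'm \<times> 'v, 'e \<times> 'v) atlas" where
  "times_vec A = (\<lambda>i. (dom_of A i \<times> UNIV, map_prod (crd A i) id))"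

definition flat_atlas :: "(unit, 'e, 'e) atlas" where
  "flat_atlas = (\<lambda>_. (UNIV, id))"

definition smooth_map ::
  "('i, 'm::topological_space, 'e::euclidean_space) atlas \<Rightarrow>
   ('j, 'n::topological_space, 'f::euclidean_space) atlas \<Rightarrow> 'm set \<Rightarrow> ('m \<Rightarrow> 'n) \<Rightarrow> bool" where
  "smooth_map A B S F \<longleftrightarrow> continuous_on S F \<and>
     (\<forall>i j. smooth_on (crd A i ` (dom_of A i \<inter> S \<inter> F -` dom_of B j))
                      (\<lambda>x. crd B j (F (par A i x))))"

definition smooth_fun ::
  "('i, 'm::topological_space, 'e::euclidean_space) atlas \<Rightarrow> 'm set \<Rightarrow> ('m \<Rightarrow> 'b::euclidean_space) \<Rightarrow> bool" where
  "smooth_fun A S h \<longleftrightarrow> (\<forall>i. smooth_on (crd A i ` (dom_of A i \<inter> S)) (\<lambda>x. h (par A i x)))"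

text \<open>\<open>D\<close> is the differential, at \<open>p\<close> and in the charts \<open>i\<close> and \<open>j\<close>, of a map defined on \<open>S\<close>.
  When \<open>S\<close> is a manifold of full dimension, possibly with boundary, \<open>D\<close> is unique.\<close>

definition has_differential ::
  "('i, 'm, 'e::euclidean_space) atlas \<Rightarrow> ('j, 'n, 'f::euclidean_space) atlas \<Rightarrow> 'm set \<Rightarrow>
   ('m \<Rightarrow> 'n) \<Rightarrow> 'i \<Rightarrow> 'j \<Rightarrow> 'm \<Rightarrow> ('e \<Rightarrow> 'f) \<Rightarrow> bool" where
  "has_differential A B S F i j p D \<longleftrightarrow>
     ((\<lambda>x. crd B j (F (par A i x))) has_derivative D) (at (crd A i p) within crd A i ` (dom_of A i \<inter> S))"

definition coord_deriv ::
  "('i, 'm, 'e::euclidean_space) atlas \<Rightarrow> 'i \<Rightarrow> ('m \<Rightarrow> 'b::euclidean_space) \<Rightarrow> 'm \<Rightarrow> 'e \<Rightarrow> 'b" where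
  "coord_deriv A i F p v = frechet_derivative (\<lambda>x. F (par A i x)) (at (crd A i p)) v"

definition jac :: "('i, 'm, 'e::euclidean_space) atlas \<Rightarrow> 'i \<Rightarrow> 'i \<Rightarrow> 'm \<Rightarrow> 'e \<Rightarrow> 'e" where
  "jac A i i' p v = coord_deriv A i (crd A i') p v"

text \<open>Tensor fields are given by their coordinate expressions: the argument \<open>i\<close> selects a chart,
  \<open>p\<close> a point of its domain, and tangent vectors at \<open>p\<close> are written in that chart. The expressions
  in different charts are related by the usual transformation law.\<close>

type_synonym ('i, 'm, 'e) vfield = "'i \<Rightarrow> 'm \<Rightarrow> 'e"
type_synonym ('i, 'm, 'e) form1 = "'i \<Rightarrow> 'm \<Rightarrow> 'e \<Rightarrow> real"
type_synonym ('i, 'm, 'e) form2 = "'i \<Rightarrow> 'm \<Rightarrow> 'e \<Rightarrow> 'e \<Rightarrow> real"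
type_synonym ('i, 'm, 'e) endo = "'i \<Rightarrow> 'm \<Rightarrow> 'e \<Rightarrow> 'e"

definition smooth_components ::
  "('i, 'm::topological_space, 'e::euclidean_space) atlas \<Rightarrow> 'm set \<Rightarrow> ('i \<Rightarrow> 'm \<Rightarrow> 'b::euclidean_space) \<Rightarrow> bool" where
  "smooth_components A S T \<longleftrightarrow>
     (\<forall>i. smooth_on (crd A i ` (dom_of A i \<inter> S)) (\<lambda>x. T i (par A i x)))"

definition vector_field ::
  "('i, 'm::topological_space, 'e::euclidean_space) atlas \<Rightarrow> 'm set \<Rightarrow> ('i, 'm, 'e) vfield \<Rightarrow> bool" where
  "vector_field A S X \<longleftrightarrow>
     (\<forall>i i'. \<forall>p \<in> S \<inter> dom_of A i \<inter> dom_of A i'. X i' p = jac A i i' p (X i p)) \<and>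
     smooth_components A S X"

definition one_form ::
  "('i, 'm::topological_space, 'e::euclidean_space) atlas \<Rightarrow> 'm set \<Rightarrow> ('i, 'm, 'e) form1 \<Rightarrow> bool" where
  "one_form A S \<alpha> \<longleftrightarrow>
     (\<forall>i. \<forall>p \<in> S \<inter> dom_of A i. linear (\<alpha> i p)) \<and>
     (\<forall>i i'. \<forall>p \<in> S \<inter> dom_of A i \<inter> dom_of A i'. \<forall>v. \<alpha> i' p (jac A i i' p v) = \<alpha> i p v) \<and>
     (\<forall>v. smooth_components A S (\<lambda>i p. \<alpha> i p v))"

definition bilinear_field ::
  "('i, 'm::topological_space, 'e::euclidean_space) atlas \<Rightarrow> 'm set \<Rightarrow> ('i, 'm, 'e) form2 \<Rightarrow> bool" where
  "bilinear_field A S \<omega> \<longleftrightarrow>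
     (\<forall>i. \<forall>p \<in> S \<inter> dom_of A i. bilinear (\<omega> i p)) \<and>
     (\<forall>i i'. \<forall>p \<in> S \<inter> dom_of A i \<inter> dom_of A i'. \<forall>v w.
        \<omega> i' p (jac A i i' p v) (jac A i i' p w) = \<omega> i p v w) \<and>
     (\<forall>v w. smooth_components A S (\<lambda>i p. \<omega> i p v w))"

definition endo_field ::
  "('i, 'm::topological_space, 'e::euclidean_space) atlas \<Rightarrow> 'm set \<Rightarrow> ('i, 'm, 'e) endo \<Rightarrow> bool" where
  "endo_field A S J \<longleftrightarrow>
     (\<forall>i. \<forall>p \<in> S \<inter> dom_of A i. linear (J i p)) \<and>
     (\<forall>i i'. \<forall>p \<in> S \<inter> dom_of A i \<inter> dom_of A i'. \<forall>v.
        J i' p (jac A i i' p v) = jac A i i' p (J i p v)) \<and>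
     (\<forall>v. smooth_components A S (\<lambda>i p. J i p v))"

definition ext_deriv ::
  "('i, 'm, 'e::euclidean_space) atlas \<Rightarrow> ('i, 'm, 'e) form1 \<Rightarrow> ('i, 'm, 'e) form2" where
  "ext_deriv A \<alpha> i p v w =
     coord_deriv A i (\<lambda>q. \<alpha> i q w) p v - coord_deriv A i (\<lambda>q. \<alpha> i q v) p w"


section \<open>Symplectic and almost complex structures\<close>

definition symplectic_form ::
  "('i, 'm::topological_space, 'e::euclidean_space) atlas \<Rightarrow> 'm set \<Rightarrow> ('i, 'm, 'e) form2 \<Rightarrow> bool" where
  "symplectic_form A S \<omega> \<longleftrightarrow> bilinear_field A S \<omega> \<and>
     (\<forall>i. \<forall>p \<in> S \<inter> dom_of A i.
        (\<forall>v. \<omega> i p v v = 0) \<and>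
        (\<forall>v. (\<forall>w. \<omega> i p v w = 0) \<longrightarrow> v = 0) \<and>
        (\<forall>a b c. coord_deriv A i (\<lambda>q. \<omega> i q b c) p a + coord_deriv A i (\<lambda>q. \<omega> i q c a) p b
                 + coord_deriv A i (\<lambda>q. \<omega> i q a b) p c = 0))"

definition almost_complex_structure ::
  "('i, 'm::topological_space, 'e::euclidean_space) atlas \<Rightarrow> 'm set \<Rightarrow> ('i, 'm, 'e) endo \<Rightarrow> bool" where
  "almost_complex_structure A S J \<longleftrightarrow> endo_field A S J \<and>
     (\<forall>i. \<forall>p \<in> S \<inter> dom_of A i. \<forall>v. J i p (J i p v) = - v)"

definition compatible_acs ::
  "('i, 'm::topological_space, 'e::euclidean_space) atlas \<Rightarrow> 'm set \<Rightarrow> ('i, 'm, 'e) form2 \<Rightarrow>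
   ('i, 'm, 'e) endo \<Rightarrow> bool" where
  "compatible_acs A S \<omega> J \<longleftrightarrow> almost_complex_structure A S J \<and>
     (\<forall>i. \<forall>p \<in> S \<inter> dom_of A i.
        (\<forall>v w. \<omega> i p (J i p v) (J i p w) = \<omega> i p v w) \<and>
        (\<forall>v. v \<noteq> 0 \<longrightarrow> \<omega> i p v (J i p v) > 0))"

text \<open>The sign convention is \<open>\<omega>(\<cdot>, X) = dh\<close>.\<close>

definition hamiltonian_vector_field ::
  "('i, 'm::topological_space, 'e::euclidean_space) atlas \<Rightarrow> 'm set \<Rightarrow> ('i, 'm, 'e) form2 \<Rightarrow>
   ('m \<Rightarrow> real) \<Rightarrow> ('i, 'm, 'e) vfield \<Rightarrow> bool" where
  "hamiltonian_vector_field A S \<omega> h X \<longleftrightarrow> vector_field A S X \<and>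
     (\<forall>i. \<forall>p \<in> S \<inter> dom_of A i. \<forall>v. \<omega> i p v (X i p) = coord_deriv A i h p v)"

definition pseudoholomorphic_map ::
  "('i, 'm::topological_space, 'e::euclidean_space) atlas \<Rightarrow>
   ('j, 'n::topological_space, 'f::euclidean_space) atlas \<Rightarrow>
   'm set \<Rightarrow> ('i, 'm, 'e) endo \<Rightarrow> ('j, 'n, 'f) endo \<Rightarrow> ('m \<Rightarrow> 'n) \<Rightarrow> bool" where
  "pseudoholomorphic_map A B S J J' F \<longleftrightarrow> smooth_map A B S F \<and>
     (\<forall>i j. \<forall>p \<in> S \<inter> dom_of A i \<inter> F -` dom_of B j. \<forall>D. has_differential A B S F i j p D \<longrightarrow>
        (\<forall>v. D (J i p v) = J' j (F p) (D v)))"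

definition pushes_forward ::
  "('i, 'm, 'e::euclidean_space) atlas \<Rightarrow> ('j, 'n, 'f::euclidean_space) atlas \<Rightarrow> 'm set \<Rightarrow>
   ('m \<Rightarrow> 'n) \<Rightarrow> ('i, 'm, 'e) vfield \<Rightarrow> ('j, 'n, 'f) vfield \<Rightarrow> bool" where
  "pushes_forward A B S F X Z \<longleftrightarrow>
     (\<forall>i j. \<forall>p \<in> S \<inter> dom_of A i \<inter> F -` dom_of B j. \<forall>D. has_differential A B S F i j p D \<longrightarrow>
        D (X i p) = Z j (F p))"


section \<open>Contact manifolds and symplectizations\<close>

text \<open>\<open>\<alpha>\<close> is nowhere zero and \<open>d\<alpha>\<close> is non-degenerate on \<open>ker \<alpha>\<close>.\<close>

definition contact_form ::
  "('j, 'q::topological_space, 'f::euclidean_space) atlas \<Rightarrow> ('j, 'q, 'f) form1 \<Rightarrow> bool" where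
  "contact_form B \<alpha> \<longleftrightarrow> one_form B UNIV \<alpha> \<and>
     (\<forall>j. \<forall>p \<in> dom_of B j.
        (\<exists>v. \<alpha> j p v \<noteq> 0) \<and>
        (\<forall>v. \<alpha> j p v = 0 \<and> (\<forall>w. \<alpha> j p w = 0 \<longrightarrow> ext_deriv B \<alpha> j p v w = 0) \<longrightarrow> v = 0))"

definition reeb_field ::
  "('j, 'q::topological_space, 'f::euclidean_space) atlas \<Rightarrow> ('j, 'q, 'f) form1 \<Rightarrow>
   ('j, 'q, 'f) vfield \<Rightarrow> bool" where
  "reeb_field B \<alpha> Y \<longleftrightarrow> vector_field B UNIV Y \<and>
     (\<forall>j. \<forall>p \<in> dom_of B j. \<alpha> j p (Y j p) = 1 \<and> (\<forall>v. ext_deriv B \<alpha> j p (Y j p) v = 0))"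

definition flow_of ::
  "('j, 'q::topological_space, 'f::euclidean_space) atlas \<Rightarrow> ('j, 'q, 'f) vfield \<Rightarrow>
   (real \<Rightarrow> 'q \<Rightarrow> 'q) \<Rightarrow> bool" where
  "flow_of B Y \<Phi> \<longleftrightarrow>
     (\<forall>x. \<Phi> 0 x = x) \<and> (\<forall>x. continuous_on UNIV (\<lambda>t. \<Phi> t x)) \<and>
     (\<forall>t x j. \<Phi> t x \<in> dom_of B j \<longrightarrow>
        ((\<lambda>s. crd B j (\<Phi> s x)) has_vector_derivative Y j (\<Phi> t x)) (at t))"

text \<open>The Reeb field and, on a closed manifold, its flow exist and are unique, so the existential
  quantifiers only name them.\<close>

definition reeb_invariant ::
  "('j, 'q::topological_space, 'f::euclidean_space) atlas \<Rightarrow> ('j, 'q, 'f) form1 \<Rightarrow>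
   ('q \<Rightarrow> real) \<Rightarrow> bool" where
  "reeb_invariant B \<alpha> f \<longleftrightarrow>
     (\<exists>Y \<Phi>. reeb_field B \<alpha> Y \<and> flow_of B Y \<Phi> \<and> (\<forall>t x. f (\<Phi> t x) = f x))"

text \<open>The 1-form \<open>R\<alpha>\<close> on the product of the contact manifold with the real line, and the region
  \<open>R \<ge> R\<^sub>0\<close>.\<close>

definition liouville_form :: "('j, 'q, 'f) form1 \<Rightarrow> ('j, 'q \<times> real, 'f \<times> real) form1" where
  "liouville_form \<alpha> j b v = snd b * \<alpha> j (fst b) (fst v)"

definition symplectization_form ::
  "('j, 'q, 'f::euclidean_space) atlas \<Rightarrow> ('j, 'q, 'f) form1 \<Rightarrow> ('j, 'q \<times> real, 'f \<times> real) form2" where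
  "symplectization_form B \<alpha> = ext_deriv (times_vec B) (liouville_form \<alpha>)"

definition end_region :: "real \<Rightarrow> ('q \<times> real) set" where
  "end_region R0 = {b. R0 \<le> snd b}"

text \<open>\<open>dR = R\<alpha> \<circ> J\<close>; in product charts \<open>dR\<close> is the second projection.\<close>

definition contact_type ::
  "('j, 'q, 'f::euclidean_space) atlas \<Rightarrow> ('j, 'q, 'f) form1 \<Rightarrow> real \<Rightarrow>
   ('j, 'q \<times> real, 'f \<times> real) endo \<Rightarrow> bool" where
  "contact_type B \<alpha> R0 J \<longleftrightarrow>
     (\<forall>j. \<forall>b \<in> end_region R0 \<inter> dom_of (times_vec B) j. \<forall>v.
        snd v = liouville_form \<alpha> j b (J j b v))"


section \<open>Geometric boundedness at infinity\<close>

definition riemannian_metric ::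
  "('i, 'm::topological_space, 'e::euclidean_space) atlas \<Rightarrow> 'm set \<Rightarrow> ('i, 'm, 'e) form2 \<Rightarrow> bool" where
  "riemannian_metric A S g \<longleftrightarrow> bilinear_field A S g \<and>
     (\<forall>i. \<forall>p \<in> S \<inter> dom_of A i.
        (\<forall>v w. g i p v w = g i p w v) \<and> (\<forall>v. v \<noteq> 0 \<longrightarrow> g i p v v > 0))"

text \<open>\<open>\<gamma>\<close> is a C1 path in \<open>S\<close>, parametrised by the unit interval, of length \<open>L\<close>.\<close>

definition C1_path_of_length ::
  "('i, 'm::topological_space, 'e::euclidean_space) atlas \<Rightarrow> 'm set \<Rightarrow> ('i, 'm, 'e) form2 \<Rightarrow>
   (real \<Rightarrow> 'm) \<Rightarrow> real \<Rightarrow> bool" where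
  "C1_path_of_length A S g \<gamma> L \<longleftrightarrow> continuous_on {0..1} \<gamma> \<and> \<gamma> ` {0..1} \<subseteq> S \<and>
     (\<exists>V \<sigma>.
        (\<forall>i. \<forall>t \<in> {0..1} \<inter> \<gamma> -` dom_of A i.
           ((\<lambda>s. crd A i (\<gamma> s)) has_vector_derivative V i t) (at t within {0..1}) \<and>
           \<sigma> t = sqrt (g i (\<gamma> t) (V i t) (V i t))) \<and>
        (\<forall>i. continuous_on ({0..1} \<inter> \<gamma> -` dom_of A i) (V i)) \<and>
        (\<sigma> has_integral L) {0..1})"

definition riemannian_dist_less ::
  "('i, 'm::topological_space, 'e::euclidean_space) atlas \<Rightarrow> 'm set \<Rightarrow> ('i, 'm, 'e) form2 \<Rightarrow>
   'm \<Rightarrow> 'm \<Rightarrow> real \<Rightarrow> bool" where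
  "riemannian_dist_less A S g p q r \<longleftrightarrow>
     (\<exists>\<gamma> L. C1_path_of_length A S g \<gamma> L \<and> \<gamma> 0 = p \<and> \<gamma> 1 = q \<and> L < r)"

definition complete_metric ::
  "('i, 'm::topological_space, 'e::euclidean_space) atlas \<Rightarrow> 'm set \<Rightarrow> ('i, 'm, 'e) form2 \<Rightarrow> bool" where
  "complete_metric A S g \<longleftrightarrow>
     (\<forall>x::nat \<Rightarrow> 'm. (\<forall>n. x n \<in> S) \<and>
        (\<forall>\<epsilon>>0. \<exists>N. \<forall>m\<ge>N. \<forall>n\<ge>N. riemannian_dist_less A S g (x m) (x n) \<epsilon>) \<longrightarrow>
        (\<exists>l\<in>S. x \<longlonglongrightarrow> l))"

text \<open>Levi-Civita connection (by the Koszul formula for coordinate fields), Riemann tensor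
  \<open>R(u,v)w\<close> and sectional curvature. They are only used at interior points of the domain of \<open>g\<close>.\<close>

definition christoffel ::
  "('i, 'm, 'e::euclidean_space) atlas \<Rightarrow> ('i, 'm, 'e) form2 \<Rightarrow> 'i \<Rightarrow> 'm \<Rightarrow> 'e \<Rightarrow> 'e \<Rightarrow> 'e" where
  "christoffel A g i p v w = (THE y. \<forall>z. 2 * g i p y z =
       coord_deriv A i (\<lambda>q. g i q w z) p v + coord_deriv A i (\<lambda>q. g i q v z) p w
       - coord_deriv A i (\<lambda>q. g i q v w) p z)"

definition riemann_tensor ::
  "('i, 'm, 'e::euclidean_space) atlas \<Rightarrow> ('i, 'm, 'e) form2 \<Rightarrow> 'i \<Rightarrow> 'm \<Rightarrow> 'e \<Rightarrow> 'e \<Rightarrow> 'e \<Rightarrow> 'e" where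
  "riemann_tensor A g i p u v w =
     coord_deriv A i (\<lambda>q. christoffel A g i q v w) p u
     - coord_deriv A i (\<lambda>q. christoffel A g i q u w) p v
     + christoffel A g i p u (christoffel A g i p v w)
     - christoffel A g i p v (christoffel A g i p u w)"

definition sectional_curvature ::
  "('i, 'm, 'e::euclidean_space) atlas \<Rightarrow> ('i, 'm, 'e) form2 \<Rightarrow> 'i \<Rightarrow> 'm \<Rightarrow> 'e \<Rightarrow> 'e \<Rightarrow> real" where
  "sectional_curvature A g i p u v =
     g i p (riemann_tensor A g i p u v v) u / (g i p u u * g i p v v - (g i p u v)\<^sup>2)"

definition geodesic ::
  "('i, 'm::topological_space, 'e::euclidean_space) atlas \<Rightarrow> ('i, 'm, 'e) form2 \<Rightarrow> (real \<Rightarrow> 'm) \<Rightarrow> bool" where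
  "geodesic A g \<gamma> \<longleftrightarrow> continuous_on {0..1} \<gamma> \<and>
     (\<forall>i. \<forall>t \<in> {0..1} \<inter> \<gamma> -` dom_of A i. \<exists>N x'. open N \<and> t \<in> N \<and>
        (\<forall>s \<in> N \<inter> {0..1}.
           ((\<lambda>r. crd A i (\<gamma> r)) has_vector_derivative x' s) (at s within {0..1})) \<and>
        (x' has_vector_derivative - christoffel A g i (\<gamma> t) (x' t) (x' t)) (at t within {0..1}))"

text \<open>The injectivity radius at \<open>p\<close> is at least \<open>r\<close>: the exponential map \<open>E\<close> at \<open>p\<close> is defined on
  the \<open>r\<close>-ball of the tangent space (written in the chart \<open>i\<close>) and is a diffeomorphism onto its
  image.\<close>

definition injectivity_radius_ge ::
  "('i, 'm::topological_space, 'e::euclidean_space) atlas \<Rightarrow> 'm set \<Rightarrow> ('i, 'm, 'e) form2 \<Rightarrow>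
   'i \<Rightarrow> 'm \<Rightarrow> real \<Rightarrow> bool" where
  "injectivity_radius_ge A S g i p r \<longleftrightarrow>
     (let b = {v. g i p v v < r\<^sup>2} in \<exists>E.
        E ` b \<subseteq> interior S \<and> E 0 = p \<and>
        (\<forall>v\<in>b. geodesic A g (\<lambda>t. E (t *\<^sub>R v)) \<and>
           ((\<lambda>t. crd A i (E (t *\<^sub>R v))) has_vector_derivative v) (at 0 within {0..1})) \<and>
        smooth_map flat_atlas A b E \<and> inj_on E b \<and>
        (\<forall>j. \<forall>v \<in> b \<inter> E -` dom_of A j. inj (frechet_derivative (\<lambda>w. crd A j (E w)) (at v))))"

text \<open>There is a complete Riemannian metric such that, outside a compact set, \<open>J\<close> is uniformly
  tamed by \<open>\<omega>\<close>, the sectional curvature is bounded above, and the injectivity radius is bounded away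
  from zero. The compact set may be enlarged, so it is harmless to let it contain the boundary.\<close>

definition geometrically_bounded_at_infinity ::
  "('i, 'm::topological_space, 'e::euclidean_space) atlas \<Rightarrow> 'm set \<Rightarrow> ('i, 'm, 'e) form2 \<Rightarrow>
   ('i, 'm, 'e) endo \<Rightarrow> bool" where
  "geometrically_bounded_at_infinity A S \<omega> J \<longleftrightarrow>
     (\<exists>g K a c \<kappa> r. riemannian_metric A S g \<and> complete_metric A S g \<and>
        compact K \<and> K \<subseteq> S \<and> frontier S \<subseteq> K \<and> a > 0 \<and> c > 0 \<and> r > 0 \<and>
        (\<forall>i. \<forall>p \<in> (S - K) \<inter> dom_of A i.
           (\<forall>v. \<omega> i p v (J i p v) \<ge> a * g i p v v) \<and>
           (\<forall>v w. \<bar>\<omega> i p v w\<bar> \<le> c * sqrt (g i p v v) * sqrt (g i p w w)) \<and>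
           (\<forall>u v. g i p u u * g i p v v \<noteq> (g i p u v)\<^sup>2 \<longrightarrow> sectional_curvature A g i p u v \<le> \<kappa>) \<and>
           injectivity_radius_ge A S g i p r))"


section \<open>Symplectic \<open>\<complex>\<^sup>*\<close>-manifolds over a convex base\<close>

text \<open>The vector field of the 1-periodic action of \<open>s \<mapsto> exp(2\<pi>is)\<close>.\<close>

definition circle_field ::
  "('i, 'y, 'e::euclidean_space) atlas \<Rightarrow> (complex \<Rightarrow> 'y \<Rightarrow> 'y) \<Rightarrow> ('i, 'y, 'e) vfield" where
  "circle_field A \<phi> i p = vector_derivative (\<lambda>s. crd A i (\<phi> (cis (2 * pi * s)) p)) (at 0)"

text \<open>Pseudoholomorphicity of the action refers to the map \<open>(y, z) \<mapsto> \<phi> z y\<close> on the product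
  \<open>Y \<times> \<complex>\<^sup>*\<close> with the product almost complex structure.\<close>

locale symplectic_Cstar_manifold =
  fixes A :: "('i, 'y::{t2_space, second_countable_topology}, 'e::euclidean_space) atlas"
    and \<omega> :: "('i, 'y, 'e) form2"
    and I :: "('i, 'y, 'e) endo"
    and \<phi> :: "complex \<Rightarrow> 'y \<Rightarrow> 'y"
    and H :: "'y \<Rightarrow> real"
  assumes manifold: "smooth_atlas A"
    and connected: "connected (UNIV :: 'y set)"
    and symplectic: "symplectic_form A UNIV \<omega>"
    and compatible: "compatible_acs A UNIV \<omega> I"
    and action_one: "\<And>y. \<phi> 1 y = y"
    and action_mult: "\<And>z w y. z \<noteq> 0 \<Longrightarrow> w \<noteq> 0 \<Longrightarrow> \<phi> (z * w) y = \<phi> z (\<phi> w y)"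
    and action_pseudoholomorphic:
      "pseudoholomorphic_map (times_vec A) A {(y, z). z \<noteq> 0}
         (\<lambda>i (y, z) (v, \<zeta>). (I i y v, \<i> * \<zeta>)) I (\<lambda>(y, z). \<phi> z y)"
    and moment_map_smooth: "smooth_fun A UNIV H"
    and moment_map: "hamiltonian_vector_field A UNIV \<omega> H (circle_field A \<phi>)"

text \<open>A compact codimension-zero submanifold with smooth boundary. In the adapted chart a point of
  \<open>D\<close> that is not interior necessarily lies on the bounding hyperplane.\<close>

definition compact_subdomain ::
  "('i, 'm::topological_space, 'e::euclidean_space) atlas \<Rightarrow> 'm set \<Rightarrow> bool" where
  "compact_subdomain A D \<longleftrightarrow> compact D \<and>
     (\<forall>p\<in>D. p \<in> interior D \<or>
        (\<exists>V \<psi>. smooth_chart A V \<psi> \<and> p \<in> V \<and>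
           (\<exists>b\<in>Basis. \<psi> ` (V \<inter> D) = \<psi> ` V \<inter> {x. x \<bullet> b \<ge> 0})))"

definition outer_part :: "'m::topological_space set \<Rightarrow> 'm set" where
  "outer_part D = - interior D"

locale symplectic_Cstar_manifold_over_convex_base = symplectic_Cstar_manifold A \<omega> I \<phi> H
  for A :: "('i, 'y::{t2_space, second_countable_topology}, 'e::euclidean_space) atlas"
    and \<omega> I \<phi> H +
  fixes Yin :: "'y set"
    and B :: "('j, 'q::{t2_space, second_countable_topology}, 'f::euclidean_space) atlas"
    and \<alpha> :: "('j, 'q, 'f) form1"
    and R0 :: real
    and IB :: "('j, 'q \<times> real, 'f \<times> real) endo"
    and f :: "'q \<Rightarrow> real"
    and \<Psi> :: "'y \<Rightarrow> 'q \<times> real"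
  assumes subdomain: "compact_subdomain A Yin"
    and contact_manifold: "smooth_atlas B"
    and contact_closed: "compact (UNIV :: 'q set)"
    and contact: "contact_form B \<alpha>"
    and base_symplectic:
      "symplectic_form (times_vec B) (end_region R0) (symplectization_form B \<alpha>)"
    and base_compatible:
      "compatible_acs (times_vec B) (end_region R0) (symplectization_form B \<alpha>) IB"
    and base_contact_type: "contact_type B \<alpha> R0 IB"
    and base_bounded:
      "geometrically_bounded_at_infinity (times_vec B) (end_region R0) (symplectization_form B \<alpha>) IB"
    and Psi_maps: "\<Psi> ` outer_part Yin \<subseteq> end_region R0"
    and Psi_proper:
      "proper_map (top_of_set (outer_part Yin)) (top_of_set (end_region R0)) \<Psi>"
    and Psi_pseudoholomorphic:
      "pseudoholomorphic_map A (times_vec B) (outer_part Yin) I IB \<Psi>"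
    and f_smooth: "smooth_fun B UNIV f"
    and f_pos: "\<And>x. f x > 0"
    and f_invariant: "reeb_invariant B \<alpha> f"
    and Psi_pushes_forward:
      "\<exists>Z. hamiltonian_vector_field (times_vec B) (end_region R0) (symplectization_form B \<alpha>)
             (\<lambda>(x, R). f x * R) Z \<and>
           pushes_forward A (times_vec B) (outer_part Yin) \<Psi> (circle_field A \<phi>) Z"


section \<open>The equations and the maximum principle\<close>

definition pseudoholomorphic_curve ::
  "('k, 's::topological_space, complex) atlas \<Rightarrow>
   ('i, 'y::topological_space, 'e::euclidean_space) atlas \<Rightarrow> ('i, 'y, 'e) endo \<Rightarrow> ('s \<Rightarrow> 'y) \<Rightarrow> bool" where
  "pseudoholomorphic_curve C A I u \<longleftrightarrow>
     pseudoholomorphic_map C A UNIV (\<lambda>k p \<zeta>. \<i> * \<zeta>) I u"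

text \<open>Every point of the domain has a local holomorphic coordinate \<open>\<zeta> = s + it\<close> in which
  \<open>\<partial>\<^sub>s u + I (\<partial>\<^sub>t u - X) = 0\<close>. The vector field may depend on the point of the domain.\<close>

definition floer_solution ::
  "('k, 's::topological_space, complex) atlas \<Rightarrow>
   ('i, 'y::topological_space, 'e::euclidean_space) atlas \<Rightarrow> ('i, 'y, 'e) endo \<Rightarrow>
   ('s \<Rightarrow> ('i, 'y, 'e) vfield) \<Rightarrow> ('s \<Rightarrow> 'y) \<Rightarrow> bool" where
  "floer_solution C A I X u \<longleftrightarrow> smooth_map C A UNIV u \<and>
     (\<forall>z0. \<exists>V \<zeta>. holomorphic_chart C V \<zeta> \<and> z0 \<in> V \<and>
        (\<forall>z\<in>V. \<forall>i. u z \<in> dom_of A i \<longrightarrow>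
           (let D = frechet_derivative (\<lambda>x. crd A i (u (inv_into V \<zeta> x))) (at (\<zeta> z))
            in D 1 + I i (u z) (D \<i> - X z i (u z)) = 0)))"

text \<open>The strong maximum principle for \<open>\<rho>\<close> on a (not necessarily open) set \<open>S\<close>. Taking \<open>W\<close> small
  shows that \<open>\<rho>\<close> is locally constant near every local maximum in the interior of \<open>S\<close>.\<close>

definition maximum_principle_on :: "'s::topological_space set \<Rightarrow> ('s \<Rightarrow> real) \<Rightarrow> bool" where
  "maximum_principle_on S \<rho> \<longleftrightarrow>
     (\<forall>W. open W \<and> connected W \<and> W \<subseteq> S \<and> (\<exists>z\<in>W. \<forall>w\<in>W. \<rho> w \<le> \<rho> z) \<longrightarrow> \<rho> constant_on W)"

end

theory Submission
  imports Defs
begin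

text \<open>Let \<open>v = \<Psi> \<circ> u\<close>, \<open>\<theta> = R\<alpha>\<close>, \<open>h = fR\<close> and \<open>Z = X\<^sub>h\<close>. Pushing Floer's equation forward along \<open>\<Psi>\<close> gives
  \<open>v\<^sub>s + I\<^sub>B (v\<^sub>t - cZ) = 0\<close>, with \<open>c = 0\<close> for pseudoholomorphic curves. Pairing \<open>\<omega>\<^sub>B(\<cdot>, Z) = dh\<close> with the
  Euler field gives \<open>\<theta>(Z) = h\<close>, and with the Reeb field \<open>dR(Z) = 0\<close> by invariance of \<open>f\<close>. With
  \<open>dR = \<theta> \<circ> I\<^sub>B\<close>, the function \<open>\<rho> = R \<circ> v\<close> satisfies \<open>d\<rho> = (\<theta>(v\<^sub>t) - c h) ds - \<theta>(v\<^sub>s) dt\<close>.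
  Differentiating once more, \<open>\<Delta>\<rho> = d\<theta>(v\<^sub>s, v\<^sub>t - cZ) = \<omega>\<^sub>B(v\<^sub>s, I\<^sub>B v\<^sub>s) \<ge> 0\<close>, so the strong maximum principle
  for subharmonic functions applies. At boundary points of the outer region one works with a local
  smooth extension of \<open>\<Psi>\<close>; the image of \<open>u\<close> stays in the outer region, so the pulled-back identities do
  not depend on it.\<close>

section \<open>Twice differentiable maps\<close>

text \<open>Meant for open \<open>S\<close>. Second derivatives are asked for pointwise, in each
  fixed direction: the Laplacian is only evaluated at points, and mixed derivatives are already
  symmetric at this regularity.\<close>

definition twice_differentiable_on ::
  "'a::euclidean_space set \<Rightarrow> ('a \<Rightarrow> 'b::euclidean_space) \<Rightarrow> bool" where
  "twice_differentiable_on S f \<longleftrightarrow> (\<forall>x\<in>S. f differentiable at x \<and>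
     (\<forall>v. (\<lambda>y. frechet_derivative f (at y) v) differentiable at x))"

lemma twice_differentiable_onD:
  assumes "twice_differentiable_on S f" "x \<in> S"
  shows "f differentiable at x" "(f has_derivative frechet_derivative f (at x)) (at x)"
    "(\<lambda>y. frechet_derivative f (at y) v) differentiable at x"
  using assms frechet_derivative_works unfolding twice_differentiable_on_def by blast+

lemma twice_differentiable_on_subset:
  "twice_differentiable_on S f \<Longrightarrow> T \<subseteq> S \<Longrightarrow> twice_differentiable_on T f"
  unfolding twice_differentiable_on_def by blast

lemma Ck_on_2_imp_twice_differentiable_on:
  assumes "Ck_on 2 S f"
  shows "twice_differentiable_on S f"
  using assms by (auto simp: twice_differentiable_on_def numeral_2_eq_2)

lemma twice_differentiable_on_cong:
  assumes "twice_differentiable_on S f" "open S" "\<And>x. x \<in> S \<Longrightarrow> g x = f x"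
  shows "twice_differentiable_on S g"
  unfolding twice_differentiable_on_def
proof (intro ballI conjI allI)
  fix x v assume x: "x \<in> S"
  note D = twice_differentiable_onD[OF assms(1)]
  have *: "frechet_derivative g (at y) = frechet_derivative f (at y)" if "y \<in> S" for y
    using frechet_derivative_transform_within_open[OF D(1)[OF that] assms(2) that] assms(3) by metis
  show "g differentiable at x"
    using D(2)[OF x] has_derivative_transform_within_open[OF _ assms(2) x]
    by (metis assms(3) differentiable_def)
  obtain L where "((\<lambda>y. frechet_derivative f (at y) v) has_derivative L) (at x)"
    using D(3)[OF x] unfolding differentiable_def by blast
  then have "((\<lambda>y. frechet_derivative g (at y) v) has_derivative L) (at x)"
    by (rule has_derivative_transform_within_open[OF _ assms(2) x]) (simp add: *)
  then show "(\<lambda>y. frechet_derivative g (at y) v) differentiable at x"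
    unfolding differentiable_def by blast
qed

text \<open>On an open set the local extension coincides with \<open>f\<close> near the point, so it
  has the same first and second derivatives there.\<close>

lemma smooth_on_imp_twice_differentiable_on:
  assumes "smooth_on S f" "open S"
  shows "twice_differentiable_on S f"
proof -
  have "\<exists>N. open N \<and> x \<in> N \<and> twice_differentiable_on N f" if "x \<in> S" for x
  proof -
    obtain N g where N: "open N" "x \<in> N" "\<And>k. Ck_on k N g" "\<And>y. y \<in> N \<inter> S \<Longrightarrow> g y = f y"
      using assms(1) \<open>x \<in> S\<close> unfolding smooth_on_def by metis
    have "twice_differentiable_on (N \<inter> S) g"
      using Ck_on_2_imp_twice_differentiable_on[OF N(3)] twice_differentiable_on_subset by blast
    then have "twice_differentiable_on (N \<inter> S) f"
      by (rule twice_differentiable_on_cong) (use N assms(2) in auto)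
    then show ?thesis
      using N(1,2) assms(2) that by blast
  qed
  then show ?thesis
    unfolding twice_differentiable_on_def by meson
qed

lemma linear_frechet_derivative:
  "f differentiable at x \<Longrightarrow> linear (frechet_derivative f (at x))"
  using frechet_derivative_works has_derivative_bounded_linear bounded_linear.linear by blast

lemma linear_eq_sum_Basis:
  fixes L :: "'a::euclidean_space \<Rightarrow> 'b::real_vector"
  assumes "linear L"
  shows "L w = (\<Sum>b\<in>Basis. (w \<bullet> b) *\<^sub>R L b)"
proof -
  have "L w = L (\<Sum>b\<in>Basis. (w \<bullet> b) *\<^sub>R b)"
    by (simp add: euclidean_representation)
  also have "\<dots> = (\<Sum>b\<in>Basis. (w \<bullet> b) *\<^sub>R L b)"
    by (simp add: linear_sum[OF assms] linear_scale[OF assms])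
  finally show ?thesis .
qed

lemma twice_differentiable_on_compose:
  assumes f: "twice_differentiable_on S f" and g: "twice_differentiable_on T g"
    and S: "open S" and fS: "f ` S \<subseteq> T"
  shows "twice_differentiable_on S (\<lambda>x. g (f x))"
  unfolding twice_differentiable_on_def
proof (intro ballI conjI allI)
  fix x v assume x: "x \<in> S"
  have fD: "(f has_derivative frechet_derivative f (at y)) (at y)" if "y \<in> S" for y
    using twice_differentiable_onD(2)[OF f that] .
  have gD: "(g has_derivative frechet_derivative g (at (f y))) (at (f y))" if "y \<in> S" for y
    using twice_differentiable_onD(2)[OF g] fS that by blast
  have comp: "((\<lambda>x. g (f x)) has_derivative
      (\<lambda>h. frechet_derivative g (at (f y)) (frechet_derivative f (at y) h))) (at y)" if "y \<in> S" for y
    using has_derivative_compose[OF fD[OF that] gD[OF that]] .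
  show "(\<lambda>x. g (f x)) differentiable at x"
    using comp[OF x] unfolding differentiable_def by blast
  \<comment> \<open>The direction \<open>frechet_derivative f (at y) v\<close> moves with
    \<open>y\<close>, while the derivative of \<open>g\<close> is controlled in fixed directions
    only; expanding over \<open>Basis\<close> moves this dependence into scalar factors.\<close>
  have eq: "frechet_derivative (\<lambda>x. g (f x)) (at y) v =
      (\<Sum>b\<in>Basis. (frechet_derivative f (at y) v \<bullet> b) *\<^sub>R frechet_derivative g (at (f y)) b)"
    if "y \<in> S" for y
  proof -
    have "frechet_derivative (\<lambda>x. g (f x)) (at y) v =
        frechet_derivative g (at (f y)) (frechet_derivative f (at y) v)"
      using frechet_derivative_at[OF comp[OF that]] by metis
    then show ?thesis
      using linear_eq_sum_Basis[OF has_derivative_linear[OF gD[OF that]]] by metis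
  qed
  have "(\<lambda>y. frechet_derivative g (at (f y)) b) differentiable at x" for b
    using differentiable_chain_at[OF twice_differentiable_onD(1)[OF f x], of "\<lambda>y. frechet_derivative g (at y) b"]
      twice_differentiable_onD(3)[OF g, of "f x"] fS x by (auto simp: o_def)
  moreover have "(\<lambda>y. frechet_derivative f (at y) v \<bullet> b) differentiable at x" for b
    using twice_differentiable_onD(3)[OF f x] by (intro differentiable_inner) auto
  ultimately have "(\<lambda>y. \<Sum>b\<in>Basis. (frechet_derivative f (at y) v \<bullet> b) *\<^sub>R frechet_derivative g (at (f y)) b)
      differentiable at x"
    by (intro differentiable_sum differentiable_scaleR) auto
  then obtain L where "((\<lambda>y. \<Sum>b\<in>Basis. (frechet_derivative f (at y) v \<bullet> b) *\<^sub>R frechet_derivative g (at (f y)) b)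
      has_derivative L) (at x)"
    unfolding differentiable_def by blast
  then have "((\<lambda>y. frechet_derivative (\<lambda>x. g (f x)) (at y) v) has_derivative L) (at x)"
    by (rule has_derivative_transform_within_open[OF _ S x]) (simp add: eq)
  then show "(\<lambda>y. frechet_derivative (\<lambda>x. g (f x)) (at y) v) differentiable at x"
    unfolding differentiable_def by blast
qed

lemma holomorphic_imp_twice_differentiable_on:
  assumes "f holomorphic_on S" "open S"
  shows "twice_differentiable_on S f"
  unfolding twice_differentiable_on_def
proof (intro ballI conjI allI)
  fix x v assume x: "x \<in> S"
  have D: "(g has_derivative (\<lambda>h. deriv g y * h)) (at y)" if "g holomorphic_on S" "y \<in> S" for g y
    using holomorphic_derivI[OF that(1) assms(2) that(2)] unfolding has_field_derivative_def .
  show "f differentiable at x"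
    using D[OF assms(1) x] unfolding differentiable_def by blast
  have eq: "frechet_derivative f (at y) v = deriv f y * v" if "y \<in> S" for y
    using frechet_derivative_at[OF D[OF assms(1) that]] by metis
  have "((\<lambda>y. deriv f y * v) has_derivative (\<lambda>h. deriv (deriv f) x * h * v)) (at x)"
    using D[OF holomorphic_deriv[OF assms] x] by (rule has_derivative_mult_left)
  then have "((\<lambda>y. frechet_derivative f (at y) v) has_derivative (\<lambda>h. deriv (deriv f) x * h * v)) (at x)"
    by (rule has_derivative_transform_within_open[OF _ assms(2) x]) (simp add: eq)
  then show "(\<lambda>y. frechet_derivative f (at y) v) differentiable at x"
    unfolding differentiable_def by blast
qed

section \<open>Symmetry of second derivatives\<close>

text \<open>The mean value theorem along \<open>v\<close>, applied to the increment of
  \<open>f\<close> in direction \<open>w\<close>, turns the second difference into a difference of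
  two values of \<open>f' y v\<close>, which the expansion \<open>L\<close> at \<open>x\<close>
  evaluates.\<close>

lemma second_difference_quotient_tendsto:
  fixes f :: "'a::real_normed_vector \<Rightarrow> real"
  assumes S: "open S" "x \<in> S"
    and f: "\<And>y. y \<in> S \<Longrightarrow> (f has_derivative f' y) (at y)"
    and L: "((\<lambda>y. f' y v) has_derivative L) (at x)"
  shows "((\<lambda>t. (f (x + t *\<^sub>R v + t *\<^sub>R w) - f (x + t *\<^sub>R v) - f (x + t *\<^sub>R w) + f x) / t\<^sup>2)
    \<longlongrightarrow> L w) (at_right 0)"
proof (rule tendstoI)
  fix e :: real assume e: "e > 0"
  \<comment> \<open>Displacements by multiples of \<open>v\<close> and \<open>w\<close> up to
    \<open>t\<close> have norm at most \<open>t * n\<close>; the summand 1 keeps \<open>n\<close>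
    positive when both vectors vanish.\<close>
  define n where "n = norm v + norm w + 1"
  have n: "n > 0" "norm v \<le> n" "norm w \<le> n"
    unfolding n_def by (auto intro: add_nonneg_pos)
  \<comment> \<open>Two errors of size \<open>\<eta> * (t * n)\<close> arise below; together they
    make \<open>e * t / 2\<close>.\<close>
  define \<eta> where "\<eta> = e / (4 * n)"
  have \<eta>: "\<eta> > 0" unfolding \<eta>_def using e n by auto
  interpret L: bounded_linear L using has_derivative_bounded_linear[OF L] .
  obtain d1 where d1: "d1 > 0" "\<And>y. norm (y - x) < d1 \<Longrightarrow>
      norm (f' y v - f' x v - L (y - x)) \<le> \<eta> * norm (y - x)"
    using L \<eta> unfolding has_derivative_at_alt by blast
  obtain d2 where d2: "d2 > 0" "ball x d2 \<subseteq> S"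
    using S open_contains_ball by blast
  define d where "d = min d1 d2 / (2 * n)"
  have d: "d > 0" unfolding d_def using d1 d2 n by auto
  have "\<bar>(f (x + t *\<^sub>R v + t *\<^sub>R w) - f (x + t *\<^sub>R v) - f (x + t *\<^sub>R w) + f x) / t\<^sup>2 - L w\<bar> < e"
    if t: "0 < t" "t < d" for t
  proof -
    have small: "norm (s *\<^sub>R v + r *\<^sub>R w) < min d1 d2 \<and> norm (s *\<^sub>R v + r *\<^sub>R w) \<le> t * n"
      if "0 \<le> s" "s \<le> t" "0 \<le> r" "r \<le> t" for s r
    proof -
      have "norm (s *\<^sub>R v + r *\<^sub>R w) \<le> s * norm v + r * norm w"
        using norm_triangle_ineq[of "s *\<^sub>R v" "r *\<^sub>R w"] that by simp
      also have "\<dots> \<le> t * norm v + t * norm w"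
        using that by (intro add_mono mult_right_mono) auto
      also have "\<dots> \<le> t * n" using t by (simp add: n_def algebra_simps)
      finally have 1: "norm (s *\<^sub>R v + r *\<^sub>R w) \<le> t * n" .
      have "t * n < d * n" using t n by simp
      also have "\<dots> \<le> min d1 d2" unfolding d_def using n d1 d2 by (auto simp: field_simps min_def)
      finally show ?thesis using 1 by linarith
    qed
    define k where "k s = f (x + s *\<^sub>R v + t *\<^sub>R w) - f (x + s *\<^sub>R v)" for s
    have kD: "(k has_real_derivative f' (x + s *\<^sub>R v + t *\<^sub>R w) v - f' (x + s *\<^sub>R v) v) (at s)"
      if "0 \<le> s" "s \<le> t" for s
    proof -
      have in1: "x + s *\<^sub>R v + t *\<^sub>R w \<in> S" "x + s *\<^sub>R v \<in> S"
        using small[of s t] small[of s 0] that t d2(2) by (auto simp: dist_norm subset_iff add.assoc norm_minus_commute)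
      have l: "linear (f' y)" if "y \<in> S" for y using f[OF that] has_derivative_linear by blast
      have line: "((\<lambda>s. x + s *\<^sub>R v) has_derivative (\<lambda>h. h *\<^sub>R v)) (at s)"
        "((\<lambda>s. x + s *\<^sub>R v + t *\<^sub>R w) has_derivative (\<lambda>h. h *\<^sub>R v)) (at s)"
        by (auto intro!: derivative_eq_intros)
      have "(k has_derivative (\<lambda>h. f' (x + s *\<^sub>R v + t *\<^sub>R w) (h *\<^sub>R v) - f' (x + s *\<^sub>R v) (h *\<^sub>R v))) (at s)"
        unfolding k_def
        using has_derivative_diff[OF has_derivative_compose[OF line(2), of f, OF f[OF in1(1)]]
            has_derivative_compose[OF line(1), of f, OF f[OF in1(2)]]] .
      moreover have "(\<lambda>h. f' (x + s *\<^sub>R v + t *\<^sub>R w) (h *\<^sub>R v) - f' (x + s *\<^sub>R v) (h *\<^sub>R v)) =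
          (*) (f' (x + s *\<^sub>R v + t *\<^sub>R w) v - f' (x + s *\<^sub>R v) v)"
        by (rule ext) (simp add: linear_scale[OF l[OF in1(1)]] linear_scale[OF l[OF in1(2)]]
            right_diff_distrib mult.commute)
      ultimately show ?thesis
        unfolding has_field_derivative_def by simp
    qed
    obtain \<xi> where \<xi>: "0 < \<xi>" "\<xi> < t"
      and k: "k t - k 0 = (t - 0) * (f' (x + \<xi> *\<^sub>R v + t *\<^sub>R w) v - f' (x + \<xi> *\<^sub>R v) v)"
      using MVT2[OF t(1), of k "\<lambda>s. f' (x + s *\<^sub>R v + t *\<^sub>R w) v - f' (x + s *\<^sub>R v) v", OF kD] by auto
    let ?a = "\<xi> *\<^sub>R v + t *\<^sub>R w" and ?b = "\<xi> *\<^sub>R v"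
    have ab: "norm ?a \<le> t * n" "norm ?a < d1" "norm ?b \<le> t * n" "norm ?b < d1"
      using small[of \<xi> t] small[of \<xi> 0] \<xi> t by auto
    have A: "\<bar>f' (x + ?a) v - f' x v - L ?a\<bar> \<le> \<eta> * (t * n)"
    proof (rule order_trans)
      show "\<bar>f' (x + ?a) v - f' x v - L ?a\<bar> \<le> \<eta> * norm (?a)"
        using d1(2)[of "x + ?a"] ab by simp
      show "\<eta> * norm (?a) \<le> \<eta> * (t * n)"
        using ab(1) \<eta> by (intro mult_left_mono) auto
    qed
    have B: "\<bar>f' (x + ?b) v - f' x v - L ?b\<bar> \<le> \<eta> * (t * n)"
    proof (rule order_trans)
      show "\<bar>f' (x + ?b) v - f' x v - L ?b\<bar> \<le> \<eta> * norm (?b)"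
        using d1(2)[of "x + ?b"] ab by simp
      show "\<eta> * norm (?b) \<le> \<eta> * (t * n)"
        using ab(3) \<eta> by (intro mult_left_mono) auto
    qed
    have Lab: "L ?a - L ?b = t * L w" by (simp add: L.add L.scaleR)
    have "\<bar>(f' (x + ?a) v - f' (x + ?b) v) - t * L w\<bar> \<le> 2 * \<eta> * (t * n)"
      using A B Lab by linarith
    also have "\<dots> < e * t"
      unfolding \<eta>_def using n e t by (simp add: field_simps)
    finally have "\<bar>(f' (x + ?a) v - f' (x + ?b) v) - t * L w\<bar> < e * t" .
    moreover have "(f (x + t *\<^sub>R v + t *\<^sub>R w) - f (x + t *\<^sub>R v) - f (x + t *\<^sub>R w) + f x) / t\<^sup>2 - L w
        = ((f' (x + ?a) v - f' (x + ?b) v) - t * L w) / t"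
    proof -
      have "f (x + t *\<^sub>R v + t *\<^sub>R w) - f (x + t *\<^sub>R v) - f (x + t *\<^sub>R w) + f x = t * (f' (x + ?a) v - f' (x + ?b) v)"
        using k by (simp add: k_def add.assoc)
      then show ?thesis using t by (simp only:) (simp add: field_simps power2_eq_square)
    qed
    ultimately show ?thesis
      using t by (simp only: abs_divide) (simp add: pos_divide_less_eq)
  qed
  then show "\<forall>\<^sub>F t in at_right 0. dist ((f (x + t *\<^sub>R v + t *\<^sub>R w) - f (x + t *\<^sub>R v) - f (x + t *\<^sub>R w) + f x) / t\<^sup>2) (L w) < e"
    unfolding eventually_at_right_field dist_real_def using d by (intro exI[of _ d]) auto
qed

text \<open>Swapping \<open>v\<close> and \<open>w\<close> leaves the second difference quotient
  unchanged, so both sides are its limit. The argument runs coordinate by coordinate, the quotient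
  being real-valued.\<close>

lemma second_derivative_symmetric:
  fixes f :: "'a::euclidean_space \<Rightarrow> 'b::euclidean_space"
  assumes f: "twice_differentiable_on S f" and S: "open S" "x \<in> S"
  shows "frechet_derivative (\<lambda>y. frechet_derivative f (at y) v) (at x) w =
    frechet_derivative (\<lambda>y. frechet_derivative f (at y) w) (at x) v"
proof (rule euclidean_eqI)
  fix b :: 'b assume b: "b \<in> Basis"
  have D1: "((\<lambda>y. f y \<bullet> b) has_derivative (\<lambda>h. frechet_derivative f (at y) h \<bullet> b)) (at y)"
    if "y \<in> S" for y
    using twice_differentiable_onD(2)[OF f that] by (rule has_derivative_inner_left)
  have D2: "((\<lambda>y. frechet_derivative f (at y) u \<bullet> b) has_derivative
      (\<lambda>h. frechet_derivative (\<lambda>y. frechet_derivative f (at y) u) (at x) h \<bullet> b)) (at x)" for u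
    using twice_differentiable_onD(3)[OF f S(2), of u] frechet_derivative_works
    by (intro has_derivative_inner_left) blast
  show "frechet_derivative (\<lambda>y. frechet_derivative f (at y) v) (at x) w \<bullet> b =
    frechet_derivative (\<lambda>y. frechet_derivative f (at y) w) (at x) v \<bullet> b"
    using second_difference_quotient_tendsto[OF S D1 D2, of v w]
      second_difference_quotient_tendsto[OF S D1 D2, of w v]
    by (intro tendsto_unique[OF trivial_limit_at_right_real]) (auto simp: algebra_simps)
qed


section \<open>The strong maximum principle for subharmonic functions\<close>

text \<open>\<open>P\<close> and \<open>Q\<close> are the partial derivatives of
  \<open>\<rho>\<close>, and \<open>P' 1 + Q' \<i>\<close> is its Laplacian at \<open>z\<close>.
  Naming the partials allows them to be supplied by explicit formulas.\<close>

definition C2_subharmonic_on :: "complex set \<Rightarrow> (complex \<Rightarrow> real) \<Rightarrow> bool" where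
  "C2_subharmonic_on U \<rho> \<longleftrightarrow> (\<exists>P Q. \<forall>z\<in>U.
     (\<rho> has_derivative (\<lambda>h. P z * Re h + Q z * Im h)) (at z) \<and>
     (\<exists>P' Q'. (P has_derivative P') (at z) \<and> (Q has_derivative Q') (at z) \<and> P' 1 + Q' \<i> \<ge> 0))"

text \<open>If \<open>l\<close> were positive, \<open>g'\<close>, which vanishes at the maximum,
  would be positive just to the right of 0, and the mean value theorem would push \<open>g\<close>
  above \<open>g 0\<close>.\<close>

lemma second_derivative_nonpos_at_local_max:
  fixes g :: "real \<Rightarrow> real"
  assumes d: "d > 0" and max: "\<And>s. \<bar>s\<bar> < d \<Longrightarrow> g s \<le> g 0"
    and g: "\<And>s. \<bar>s\<bar> < d \<Longrightarrow> (g has_real_derivative g' s) (at s)"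
    and g': "(g' has_real_derivative l) (at 0)"
  shows "l \<le> 0"
proof (rule ccontr)
  assume "\<not> l \<le> 0"
  have 0: "g' 0 = 0"
    using DERIV_local_max[OF g[of 0] d] max d by simp
  obtain e where e: "e > 0" "\<And>h. 0 < h \<Longrightarrow> h < e \<Longrightarrow> g' 0 < g' (0 + h)"
    using DERIV_pos_inc_right[OF g'] \<open>\<not> l \<le> 0\<close> by auto
  define t where "t = min d e / 2"
  have t: "0 < t" "t < d" "t < e" using d e by (auto simp: t_def)
  obtain \<xi> where "0 < \<xi>" "\<xi> < t" "g t - g 0 = (t - 0) * g' \<xi>"
    using MVT2[OF t(1), of g g'] g t by auto
  moreover have "g' \<xi> > 0" using e(2)[of \<xi>] \<open>0 < \<xi>\<close> \<open>\<xi> < t\<close> t 0 by simp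
  ultimately have "g t > g 0" using t by (metis diff_gt_0_iff_gt diff_zero mult_pos_pos)
  then show False using max[of t] t by simp
qed

lemma partial_second_derivative_nonpos_at_local_max:
  fixes \<rho> :: "complex \<Rightarrow> real"
  assumes U: "open U" "z \<in> U"
    and \<rho>: "\<And>y. y \<in> U \<Longrightarrow> (\<rho> has_derivative D y) (at y)"
    and max: "\<And>y. y \<in> U \<Longrightarrow> \<rho> y \<le> \<rho> z"
    and D: "((\<lambda>y. D y v) has_derivative L) (at z)"
  shows "L v \<le> 0"
proof -
  obtain e where e: "e > 0" "ball z e \<subseteq> U" using U open_contains_ball by blast
  define d where "d = e / (norm v + 1)"
  have nv: "norm v + 1 > 0" by (simp add: add_nonneg_pos)
  have d: "d > 0" using e nv by (simp add: d_def)
  have inU: "z + s *\<^sub>R v \<in> U" if "\<bar>s\<bar> < d" for s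
  proof -
    have "\<bar>s\<bar> * norm v \<le> \<bar>s\<bar> * (norm v + 1)" by (simp add: mult_left_mono)
    also have "\<dots> < e" using that nv by (simp add: d_def field_simps)
    finally show ?thesis using e by (auto simp: dist_norm subset_iff)
  qed
  have line: "((\<lambda>s. z + s *\<^sub>R v) has_derivative (\<lambda>h. h *\<^sub>R v)) (at s)" for s
    by (auto intro!: derivative_eq_intros)
  show ?thesis
  proof (rule second_derivative_nonpos_at_local_max[OF d, of "\<lambda>s. \<rho> (z + s *\<^sub>R v)" "\<lambda>s. D (z + s *\<^sub>R v) v"])
    show "\<rho> (z + s *\<^sub>R v) \<le> \<rho> (z + 0 *\<^sub>R v)" if "\<bar>s\<bar> < d" for s using max[OF inU[OF that]] by simp
    show "((\<lambda>s. \<rho> (z + s *\<^sub>R v)) has_real_derivative D (z + s *\<^sub>R v) v) (at s)" if "\<bar>s\<bar> < d" for s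
      using has_derivative_compose[OF line \<rho>[OF inU[OF that]]]
        linear_scale[OF has_derivative_linear[OF \<rho>[OF inU[OF that]]]]
      by (simp add: has_field_derivative_def mult_commute_abs)
    have "((\<lambda>y. D y v) has_derivative L) (at (z + 0 *\<^sub>R v))" using D by simp
    from has_derivative_compose[OF line this]
    show "((\<lambda>s. D (z + s *\<^sub>R v) v) has_real_derivative L v) (at 0)"
      using linear_scale[OF has_derivative_linear[OF D]]
      by (simp add: has_field_derivative_def mult_commute_abs)
  qed
qed

text \<open>Hopf's boundary point argument with the barrier \<open>1 / \<bar>z - w\<bar>\<^sup>2\<close>, whose Laplacian
  \<open>4 / \<bar>z - w\<bar>\<^sup>4\<close> is positive.\<close>

lemma subharmonic_no_boundary_touching:
  assumes U: "open U" and sub: "C2_subharmonic_on U \<rho>"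
    and r: "r > 0" "cball w r \<subseteq> U"
    and max: "\<And>z. z \<in> U \<Longrightarrow> \<rho> z \<le> M"
    and less: "\<And>z. z \<in> ball w r \<Longrightarrow> \<rho> z < M"
    and p: "dist w p = r"
  shows "\<rho> p < M"
proof (rule ccontr)
  assume "\<not> \<rho> p < M"
  have pU: "p \<in> U" using p r by auto
  then have \<rho>p: "\<rho> p = M" using max \<open>\<not> \<rho> p < M\<close> by force
  obtain P Q where
    \<rho>D: "\<And>z. z \<in> U \<Longrightarrow> (\<rho> has_derivative (\<lambda>h. P z * Re h + Q z * Im h)) (at z)" and
    PQ: "\<And>z. z \<in> U \<Longrightarrow> \<exists>P' Q'. (P has_derivative P') (at z) \<and> (Q has_derivative Q') (at z) \<and> P' 1 + Q' \<i> \<ge> 0"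
    using sub unfolding C2_subharmonic_on_def by blast
  have cont: "continuous_on U \<rho>"
    using \<rho>D by (meson continuous_at_imp_continuous_on has_derivative_continuous)
  \<comment> \<open>This compact circle lies inside the open disc, so the maximum of
    \<open>\<rho>\<close> on it is strictly below \<open>M\<close>; the gap pays for the
    barrier.\<close>
  define S where "S = sphere w (r/2)"
  have SU: "S \<subseteq> U" "S \<subseteq> ball w r" "S \<noteq> {}" "compact S"
    using r by (auto simp: S_def subset_iff)
  obtain y0 where y0: "y0 \<in> S" "\<And>y. y \<in> S \<Longrightarrow> \<rho> y \<le> \<rho> y0"
    using continuous_attains_sup[OF SU(4,3) continuous_on_subset[OF cont SU(1)]] by blast
  \<comment> \<open>The barrier \<open>e * (1 / q z - 1 / r\<^sup>2)\<close> vanishes on the outer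
    circle. On the inner one, where \<open>q z = r\<^sup>2 / 4\<close>, it equals
    \<open>3 * e / r\<^sup>2\<close>, which is exactly the gap \<open>M - \<rho> y0\<close>.\<close>
  define e where "e = (M - \<rho> y0) * r\<^sup>2 / 3"
  have e: "e > 0" using less y0(1) SU(2) r(1) by (auto simp: e_def)
  define q where "q z = (Re z - Re w)\<^sup>2 + (Im z - Im w)\<^sup>2" for z
  have q: "q z = (dist w z)\<^sup>2" for z
    by (simp add: q_def dist_norm cmod_def power2_commute)
  define \<psi> where "\<psi> z = \<rho> z + e * (1 / q z - 1 / r\<^sup>2)" for z
  define K where "K = cball w r - ball w (r/2)"
  have K: "compact K" "p \<in> K" "K \<subseteq> U"
    unfolding K_def using p r by (auto intro: compact_diff)
  have qpos: "q z > 0" if "z \<noteq> w" for z using that by (simp add: q)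
  have qD: "(q has_derivative (\<lambda>h. 2 * (Re z - Re w) * Re h + 2 * (Im z - Im w) * Im h)) (at z)" for z
    unfolding q_def by (auto intro!: derivative_eq_intros simp: fun_eq_iff algebra_simps)
  have hD: "((\<lambda>z. e * (1 / q z - 1 / r\<^sup>2)) has_derivative
     (\<lambda>h. (- 2 * e * (Re z - Re w) / (q z)\<^sup>2) * Re h + (- 2 * e * (Im z - Im w) / (q z)\<^sup>2) * Im h)) (at z)"
    if "z \<noteq> w" for z
  proof -
    have "((\<lambda>s. e * (1 / s - 1 / r\<^sup>2)) has_real_derivative (- e / (q z)\<^sup>2)) (at (q z))"
      using qpos[OF that] by (auto intro!: derivative_eq_intros simp: power2_eq_square)
    from DERIV_compose_FDERIV[OF this qD] show ?thesis
      by (rule has_derivative_eq_rhs) (simp add: fun_eq_iff algebra_simps add_divide_distrib diff_divide_distrib)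
  qed
  have Kw: "z \<noteq> w" if "z \<in> K" for z using that r by (auto simp: K_def)
  have \<psi>D: "(\<psi> has_derivative
     (\<lambda>h. (P z - 2 * e * (Re z - Re w) / (q z)\<^sup>2) * Re h + (Q z - 2 * e * (Im z - Im w) / (q z)\<^sup>2) * Im h)) (at z)"
    if "z \<in> U" "z \<noteq> w" for z
    unfolding \<psi>_def
    by (rule has_derivative_eq_rhs[OF has_derivative_add[OF \<rho>D[OF that(1)] hD[OF that(2)]]])
      (simp add: fun_eq_iff algebra_simps diff_divide_distrib)
  have \<psi>cont: "continuous_on K \<psi>"
    using \<psi>D K(3) Kw by (meson continuous_at_imp_continuous_on has_derivative_continuous subsetD)
  obtain y where y: "y \<in> K" "\<And>z. z \<in> K \<Longrightarrow> \<psi> z \<le> \<psi> y"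
    using continuous_attains_sup[OF K(1) _ \<psi>cont] K(2) by blast
  \<comment> \<open>On the two boundary circles this is the choice of the barrier. An interior
    maximum is impossible, because the Laplacian of \<open>\<psi>\<close> is at least
    \<open>4 * e / (q y)\<^sup>2 > 0\<close>.\<close>
  have "\<psi> y \<le> M"
  proof -
    consider "dist w y = r" | "dist w y = r/2" | "r/2 < dist w y" "dist w y < r"
      using y(1) by (fastforce simp: K_def)
    then show ?thesis
    proof cases
      case 1
      then show ?thesis using max[of y] y(1) K(3) by (auto simp: \<psi>_def q)
    next
      case 2
      have qy: "q y = r\<^sup>2 / 4" by (simp only: q 2) (simp add: power_divide)
      have "\<psi> y = \<rho> y + (M - \<rho> y0) * r\<^sup>2 / 3 * (1 / (r\<^sup>2 / 4) - 1 / r\<^sup>2)"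
        by (simp only: \<psi>_def e_def qy)
      also have "\<dots> = \<rho> y + (M - \<rho> y0)"
        using r(1) by (simp add: field_simps)
      finally have "\<psi> y = \<rho> y + (M - \<rho> y0)" .
      moreover have "\<rho> y \<le> \<rho> y0" using 2 y0(2) by (simp add: S_def)
      ultimately show ?thesis by simp
    next
      case 3
      define V where "V = ball w r - cball w (r/2)"
      have V: "open V" "y \<in> V" "V \<subseteq> K" using 3 by (auto simp: V_def K_def)
      have VU: "z \<in> U" "z \<noteq> w" if "z \<in> V" for z using that V K Kw by auto
      have yU: "y \<in> U" "y \<noteq> w" "q y > 0" using VU[OF V(2)] qpos by auto
      obtain P' Q' where P': "(P has_derivative P') (at y)" "(Q has_derivative Q') (at y)" "P' 1 + Q' \<i> \<ge> 0"
        using PQ[OF yU(1)] by blast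
      define a where "a = Re y - Re w"
      define b where "b = Im y - Im w"
      have qy: "q y = a\<^sup>2 + b\<^sup>2" by (simp add: q_def a_def b_def)
      have iD: "((\<lambda>z. 1 / (q z)\<^sup>2) has_derivative (\<lambda>h. (2 * a * Re h + 2 * b * Im h) * (- 2 / (q y)^3))) (at y)"
      proof -
        have "((\<lambda>s. 1 / s\<^sup>2) has_real_derivative (- 2 / (q y)^3)) (at (q y))"
          using yU(3) by (auto intro!: derivative_eq_intros simp: power2_eq_square power3_eq_cube)
        from DERIV_compose_FDERIV[OF this qD] show ?thesis unfolding a_def b_def .
      qed
      have reD: "((\<lambda>z. 2 * e * (Re z - Re w)) has_derivative (\<lambda>h. 2 * e * Re h)) (at y)"
        and imD: "((\<lambda>z. 2 * e * (Im z - Im w)) has_derivative (\<lambda>h. 2 * e * Im h)) (at y)"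
        by (auto intro!: derivative_eq_intros)
      \<comment> \<open>\<open>D1\<close> and \<open>D2\<close> differentiate the two partial
        derivatives of \<open>\<psi>\<close>. The factors \<open>Re 1\<close>, \<open>Im 1\<close>,
        \<open>Re \<i>\<close> and \<open>Im \<i>\<close> are kept so that both match the gradient
        formula \<open>\<psi>DV\<close> at 1 and at \<open>\<i>\<close>.\<close>
      have D1: "((\<lambda>z. (P z - 2 * e * (Re z - Re w) / (q z)\<^sup>2) * Re 1 + (Q z - 2 * e * (Im z - Im w) / (q z)\<^sup>2) * Im 1)
          has_derivative (\<lambda>h. P' h - 2 * e * (Re h / (q y)\<^sup>2 - 2 * a * (2 * a * Re h + 2 * b * Im h) / (q y)^3))) (at y)"
        using has_derivative_diff[OF P'(1) has_derivative_mult[OF reD iD]]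
        by (simp add: a_def[symmetric] b_def[symmetric]) (erule has_derivative_eq_rhs, simp add: fun_eq_iff algebra_simps)
      have D2: "((\<lambda>z. (P z - 2 * e * (Re z - Re w) / (q z)\<^sup>2) * Re \<i> + (Q z - 2 * e * (Im z - Im w) / (q z)\<^sup>2) * Im \<i>)
          has_derivative (\<lambda>h. Q' h - 2 * e * (Im h / (q y)\<^sup>2 - 2 * b * (2 * a * Re h + 2 * b * Im h) / (q y)^3))) (at y)"
        using has_derivative_diff[OF P'(2) has_derivative_mult[OF imD iD]]
        by (simp add: a_def[symmetric] b_def[symmetric]) (erule has_derivative_eq_rhs, simp add: fun_eq_iff algebra_simps)
      have \<psi>DV: "(\<psi> has_derivative
          (\<lambda>h. (P z - 2 * e * (Re z - Re w) / (q z)\<^sup>2) * Re h + (Q z - 2 * e * (Im z - Im w) / (q z)\<^sup>2) * Im h)) (at z)"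
        if "z \<in> V" for z
        using \<psi>D VU that by blast
      note nonpos = partial_second_derivative_nonpos_at_local_max[OF V(1,2) \<psi>DV]
      have "P' 1 - 2 * e * (1 / (q y)\<^sup>2 - 4 * a\<^sup>2 / (q y)^3) \<le> 0"
        using nonpos[OF _ _ D1] y(2) V(3) by (simp add: power2_eq_square subset_iff)
      moreover have "Q' \<i> - 2 * e * (1 / (q y)\<^sup>2 - 4 * b\<^sup>2 / (q y)^3) \<le> 0"
        using nonpos[OF _ _ D2] y(2) V(3) by (simp add: power2_eq_square subset_iff)
      moreover have "2 * e * (1 / (q y)\<^sup>2 - 4 * a\<^sup>2 / (q y)^3) + 2 * e * (1 / (q y)\<^sup>2 - 4 * b\<^sup>2 / (q y)^3)
          = 2 * e * (2 / (q y)\<^sup>2 - 4 * q y / (q y)^3)"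
        unfolding qy by (simp add: algebra_simps add_divide_distrib)
      moreover have "2 * e * (2 / (q y)\<^sup>2 - 4 * q y / (q y)^3) = - 4 * e / (q y)\<^sup>2"
        using yU(3) by (simp add: field_simps power2_eq_square power3_eq_cube)
      moreover have "- 4 * e / (q y)\<^sup>2 < 0" using e yU(3) by simp
      ultimately show ?thesis using P'(3) by linarith
    qed
  qed
  have pw: "p \<noteq> w" "q p = r\<^sup>2" using p r by (auto simp: q)
  \<comment> \<open>As \<open>p\<close> is an interior maximum of \<open>\<rho>\<close> on
    \<open>U\<close>, the gradient of \<open>\<rho>\<close> vanishes there, and only the barrier
    contributes to the inward slope of \<open>\<psi>\<close>.\<close>
  have "(\<lambda>h. P p * Re h + Q p * Im h) = (\<lambda>h. 0)"
    using differential_zero_maxmin[OF pU U \<rho>D[OF pU]] max \<rho>p by blast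
  then have zero: "P p * Re h + Q p * Im h = 0" for h by meson
  \<comment> \<open>Along the radius from \<open>p\<close> to the centre, \<open>\<psi>\<close>
    starts at \<open>M\<close> with slope \<open>2 * e / r\<^sup>2 > 0\<close>, so it exceeds its
    bound on \<open>K\<close>.\<close>
  define k where "k t = \<psi> (p + t *\<^sub>R (w - p))" for t
  have lD: "((\<lambda>t. p + t *\<^sub>R (w - p)) has_derivative (\<lambda>t. t *\<^sub>R (w - p))) (at 0)"
    by (auto intro!: derivative_eq_intros)
  have "(\<psi> has_derivative (\<lambda>h. (P p - 2 * e * (Re p - Re w) / (q p)\<^sup>2) * Re h + (Q p - 2 * e * (Im p - Im w) / (q p)\<^sup>2) * Im h))
      (at (p + 0 *\<^sub>R (w - p)))" using \<psi>D[OF pU pw(1)] by simp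
  from has_derivative_compose[OF lD, of \<psi>, OF this]
  have "(k has_derivative (\<lambda>t. (P p - 2 * e * (Re p - Re w) / (q p)\<^sup>2) * (t * (Re w - Re p))
      + (Q p - 2 * e * (Im p - Im w) / (q p)\<^sup>2) * (t * (Im w - Im p)))) (at 0)"
    unfolding k_def by (simp only: scaleR_complex.sel minus_complex.sel)
  moreover have "(P p - 2 * e * (Re p - Re w) / (q p)\<^sup>2) * (t * (Re w - Re p))
      + (Q p - 2 * e * (Im p - Im w) / (q p)\<^sup>2) * (t * (Im w - Im p)) = (2 * e / r\<^sup>2) * t" for t
  proof -
    have "(P p - 2 * e * (Re p - Re w) / (q p)\<^sup>2) * (t * (Re w - Re p))
      + (Q p - 2 * e * (Im p - Im w) / (q p)\<^sup>2) * (t * (Im w - Im p))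
      = t * (P p * Re (w - p) + Q p * Im (w - p)) + 2 * e * t * q p / (q p)\<^sup>2"
      unfolding q_def by (simp add: algebra_simps power2_eq_square add_divide_distrib diff_divide_distrib)
    then show ?thesis using zero[of "w - p"] pw(2) r(1) by (simp add: power2_eq_square)
  qed
  ultimately have "(k has_real_derivative (2 * e / r\<^sup>2)) (at 0)"
    by (simp only: has_field_derivative_def)
  then obtain d where d: "d > 0" "\<And>h. 0 < h \<Longrightarrow> h < d \<Longrightarrow> k 0 < k (0 + h)"
    using DERIV_pos_inc_right[of k "2 * e / r\<^sup>2" 0] e r by auto
  \<comment> \<open>Since \<open>t \<le> 1/2\<close>, the point keeps distance
    \<open>(1 - t) * r \<ge> r/2\<close> from \<open>w\<close> and stays in the annulus
    \<open>K\<close>.\<close>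
  define t where "t = min d 1 / 2"
  have t: "0 < t" "t < d" "t \<le> 1/2" using d by (auto simp: t_def)
  have "w - (p + t *\<^sub>R (w - p)) = (1 - t) *\<^sub>R (w - p)" by (simp add: algebra_simps)
  then have "dist w (p + t *\<^sub>R (w - p)) = (1 - t) * r"
    using p t by (simp add: dist_norm)
  then have "p + t *\<^sub>R (w - p) \<in> K"
    unfolding K_def using mult_right_mono[of t "1/2" r] mult_pos_pos[OF t(1) r(1)] t(3) r(1)
    by (auto simp: left_diff_distrib)
  then have "k t \<le> M" using y(2) \<open>\<psi> y \<le> M\<close> unfolding k_def by force
  moreover have "k 0 = M" using \<rho>p pw(2) by (simp add: k_def \<psi>_def)
  ultimately show False using d(2)[of t] t by simp
qed

text \<open>If \<open>\<rho>\<close> were smaller at a nearby \<open>w\<close>, a disc growing about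
  \<open>w\<close> would first meet the maximum set at a boundary point \<open>p\<close>, which the
  boundary point lemma forbids.\<close>

lemma subharmonic_constant_near_max:
  assumes U: "open U" "x \<in> U" and sub: "C2_subharmonic_on U \<rho>"
    and max: "\<And>z. z \<in> U \<Longrightarrow> \<rho> z \<le> \<rho> x"
  shows "\<exists>\<epsilon>>0. \<forall>z\<in>ball x \<epsilon>. \<rho> z = \<rho> x"
proof -
  obtain \<epsilon> where \<epsilon>: "\<epsilon> > 0" "ball x \<epsilon> \<subseteq> U" using U open_contains_ball by blast
  have cont: "continuous_on U \<rho>"
    using sub unfolding C2_subharmonic_on_def
    by (meson continuous_at_imp_continuous_on has_derivative_continuous)
  \<comment> \<open>Halving the radius keeps the whole closed disc about \<open>w\<close> through
    \<open>x\<close> inside \<open>ball x \<epsilon>\<close>.\<close>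
  have "\<rho> w = \<rho> x" if w: "w \<in> ball x (\<epsilon>/2)" for w
  proof (rule ccontr)
    assume neq: "\<rho> w \<noteq> \<rho> x"
    define c where "c = cball w (dist w x)"
    have cU: "c \<subseteq> U"
    proof
      fix z assume "z \<in> c"
      then have "dist x z < \<epsilon>" using w dist_triangle[of x z w] by (auto simp: c_def dist_commute)
      then show "z \<in> U" using \<epsilon>(2) by auto
    qed
    \<comment> \<open>Intersecting with the closed disc \<open>c\<close> makes \<open>E\<close>
      closed, so a point nearest to \<open>w\<close> exists; as \<open>x \<in> E\<close>, the
      touching disc stays within \<open>c\<close>.\<close>
    define E where "E = {z \<in> c. \<rho> z = \<rho> x}"
    have E: "closed E"
      unfolding E_def
      using continuous_closed_preimage_constant[OF continuous_on_subset[OF cont cU]] by (simp add: c_def)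
    have xE: "x \<in> E" by (simp add: E_def c_def)
    obtain p where p: "p \<in> E" "\<And>z. z \<in> E \<Longrightarrow> dist w p \<le> dist w z"
      using distance_attains_inf[OF E, of w] xE by blast
    define r where "r = dist w p"
    have r: "r > 0" "r \<le> dist w x" using p xE neq by (auto simp: r_def E_def)
    have "cball w r \<subseteq> U" using r cU by (auto simp: c_def)
    moreover have "\<rho> z < \<rho> x" if "z \<in> ball w r" for z
    proof -
      have "z \<in> c" "z \<notin> E" using that r p(2)[of z] by (auto simp: c_def r_def)
      then show ?thesis using max[of z] cU by (force simp: E_def)
    qed
    ultimately have "\<rho> p < \<rho> x"
      using subharmonic_no_boundary_touching[OF U(1) sub r(1) _ max] r_def by blast
    then show False using p(1) by (simp add: E_def)
  qed
  then show ?thesis using \<epsilon>(1) by (meson half_gt_zero)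
qed


section \<open>Subharmonicity in flat coordinates\<close>

text \<open>A product rule for a form evaluated on a moving vector. Differentiability of
  \<open>\<theta>\<close> is given for fixed vectors, so the value is expanded over
  \<open>Basis\<close>, and coefficients and components are differentiated separately.\<close>

lemma has_derivative_linear_field:
  fixes \<theta> :: "'b::real_normed_vector \<Rightarrow> 'e::euclidean_space \<Rightarrow> real"
  assumes G: "open G" "v z \<in> G" and lin: "\<And>y. y \<in> G \<Longrightarrow> linear (\<theta> y)"
    and \<theta>: "\<And>w. (\<lambda>y. \<theta> y w) differentiable at (v z)"
    and v: "(v has_derivative Dv) (at z)" and a: "(a has_derivative Da) (at z)"
  shows "((\<lambda>x. \<theta> (v x) (a x)) has_derivative
    (\<lambda>h. \<theta> (v z) (Da h) + frechet_derivative (\<lambda>y. \<theta> y (a z)) (at (v z)) (Dv h))) (at z)"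
proof -
  let ?D = "\<lambda>w. frechet_derivative (\<lambda>y. \<theta> y w) (at (v z))"
  have \<theta>D: "((\<lambda>y. \<theta> y w) has_derivative ?D w) (at (v z))" for w
    using \<theta> frechet_derivative_works by blast
  have expand: "\<theta> y w = (\<Sum>b\<in>Basis. (w \<bullet> b) * \<theta> y b)" if "y \<in> G" for y w
    using linear_eq_sum_Basis[OF lin[OF that], of w] by simp
  have "((\<lambda>y. \<Sum>b\<in>Basis. (w \<bullet> b) * \<theta> y b) has_derivative (\<lambda>h. \<Sum>b\<in>Basis. (w \<bullet> b) * ?D b h)) (at (v z))" for w
    by (intro has_derivative_sum has_derivative_mult_right \<theta>D)
  then have "((\<lambda>y. \<theta> y w) has_derivative (\<lambda>h. \<Sum>b\<in>Basis. (w \<bullet> b) * ?D b h)) (at (v z))" for w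
    by (rule has_derivative_transform_within_open[OF _ G]) (rule expand[symmetric])
  from has_derivative_unique[OF \<theta>D this]
  \<comment> \<open>The derivative in the base point inherits linearity in \<open>w\<close>; this
    reassembles the basis sum at the end.\<close>
  have D: "?D w h = (\<Sum>b\<in>Basis. (w \<bullet> b) * ?D b h)" for w h
    by (rule fun_cong)
  obtain N where N: "open N" "z \<in> N" "\<And>x. x \<in> N \<Longrightarrow> v x \<in> G"
    using has_derivative_continuous[OF v, unfolded continuous_at_open, rule_format, OF conjI[OF G]] by auto
  have "((\<lambda>x. \<Sum>b\<in>Basis. (a x \<bullet> b) * \<theta> (v x) b) has_derivative
      (\<lambda>h. \<Sum>b\<in>Basis. (a z \<bullet> b) * ?D b (Dv h) + (Da h \<bullet> b) * \<theta> (v z) b)) (at z)"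
    by (intro has_derivative_sum has_derivative_mult has_derivative_inner_left a
        has_derivative_compose[OF v \<theta>D])
  then have "((\<lambda>x. \<Sum>b\<in>Basis. (a x \<bullet> b) * \<theta> (v x) b) has_derivative
      (\<lambda>h. \<theta> (v z) (Da h) + ?D (a z) (Dv h))) (at z)"
    by (simp only: expand[OF G(2), of "Da _"] D[of "a z"] sum.distrib add.commute)
  then show ?thesis
    by (rule has_derivative_transform_within_open[OF _ N(1,2)]) (rule expand[OF N(3), symmetric])
qed

text \<open>The first derivatives of \<open>r (v z)\<close> are expressed through
  \<open>\<theta>\<close> and \<open>h\<close>, so \<open>J\<close> has disappeared before the
  second differentiation. Hence \<open>J\<close> and \<open>Z\<close> enter by their values along
  \<open>v\<close> and are indexed by domain points, whereas \<open>\<theta>\<close> and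
  \<open>h\<close>, which get differentiated, are given on an open set \<open>G\<close>.\<close>

lemma floer_equation_imp_subharmonic:
  fixes v :: "complex \<Rightarrow> 'e::euclidean_space" and \<theta> :: "'e \<Rightarrow> 'e \<Rightarrow> real"
    and h :: "'e \<Rightarrow> real" and r :: "'e \<Rightarrow> real" and J :: "complex \<Rightarrow> 'e \<Rightarrow> 'e"
  defines "d\<theta> \<equiv> \<lambda>y a b. frechet_derivative (\<lambda>x. \<theta> x b) (at y) a - frechet_derivative (\<lambda>x. \<theta> x a) (at y) b"
    and "Dv \<equiv> \<lambda>z. frechet_derivative v (at z)"
  assumes V: "open V" and v: "twice_differentiable_on V v"
    and G: "open G" "v ` V \<subseteq> G"
    and lin: "\<And>y. y \<in> G \<Longrightarrow> linear (\<theta> y)"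
    and \<theta>: "\<And>y w. y \<in> G \<Longrightarrow> (\<lambda>x. \<theta> x w) differentiable at y"
    and h: "\<And>y. y \<in> G \<Longrightarrow> h differentiable at y"
    and r: "bounded_linear r"
    and J: "\<And>z. z \<in> V \<Longrightarrow> linear (J z)" "\<And>z w. z \<in> V \<Longrightarrow> J z (J z w) = - w"
    and contact: "\<And>z w. z \<in> V \<Longrightarrow> r w = \<theta> (v z) (J z w)"
    and tame: "\<And>z w. z \<in> V \<Longrightarrow> d\<theta> (v z) w (J z w) \<ge> 0"
    and Z: "\<And>z w. z \<in> V \<Longrightarrow> d\<theta> (v z) w (Z z) = frechet_derivative h (at (v z)) w"
    and \<theta>Z: "\<And>z. z \<in> V \<Longrightarrow> \<theta> (v z) (Z z) = h (v z)"
    and rZ: "\<And>z. z \<in> V \<Longrightarrow> r (Z z) = 0"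
    and floer: "\<And>z. z \<in> V \<Longrightarrow> Dv z 1 + J z (Dv z \<i> - c *\<^sub>R Z z) = 0"
  shows "C2_subharmonic_on V (\<lambda>z. r (v z))"
proof -
  define P where "P z = \<theta> (v z) (Dv z \<i>) - c * h (v z)" for z
  define Q where "Q z = - \<theta> (v z) (Dv z 1)" for z
  have "((\<lambda>z. r (v z)) has_derivative (\<lambda>k. P z * Re k + Q z * Im k)) (at z) \<and>
    (\<exists>P' Q'. (P has_derivative P') (at z) \<and> (Q has_derivative Q') (at z) \<and> P' 1 + Q' \<i> \<ge> 0)"
    if z: "z \<in> V" for z
  proof
    have vO: "v z \<in> G" using G z by blast
    note linJ = J(1)[OF z] and lin\<theta> = lin[OF vO]
    have vD: "(v has_derivative Dv z) (at z)"
      using twice_differentiable_onD(2)[OF v z] by (simp add: Dv_def)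
    have Js: "J z (Dv z 1) = Dv z \<i> - c *\<^sub>R Z z"
    proof -
      have "Dv z 1 = - J z (Dv z \<i> - c *\<^sub>R Z z)" using floer[OF z] by (simp add: eq_neg_iff_add_eq_0)
      then show ?thesis using J(2)[OF z] linear_neg[OF linJ] by simp
    qed
    have Jt: "J z (Dv z \<i>) = c *\<^sub>R J z (Z z) - Dv z 1"
      using floer[OF z] by (simp add: linear_diff[OF linJ] linear_scale[OF linJ] algebra_simps add_eq_0_iff)
    have rs: "r (Dv z 1) = P z"
      using contact[OF z, of "Dv z 1"]
      by (simp add: P_def Js linear_diff[OF lin\<theta>] linear_scale[OF lin\<theta>] \<theta>Z[OF z])
    \<comment> \<open>The contribution of \<open>J z (Z z)\<close> drops out: by the contact
      condition its \<open>\<theta>\<close>-value is \<open>r (Z z) = 0\<close>.\<close>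
    have rt: "r (Dv z \<i>) = Q z"
      using contact[OF z, of "Dv z \<i>"] contact[OF z, of "Z z"] rZ[OF z]
      by (simp add: Q_def Jt linear_diff[OF lin\<theta>] linear_scale[OF lin\<theta>])
    have "r (Dv z k) = P z * Re k + Q z * Im k" for k
    proof -
      have "k = Re k *\<^sub>R 1 + Im k *\<^sub>R \<i>" by (simp add: complex_eq_iff)
      then have "r (Dv z k) = r (Dv z (Re k *\<^sub>R 1 + Im k *\<^sub>R \<i>))" by simp
      also have "\<dots> = Re k * r (Dv z 1) + Im k * r (Dv z \<i>)"
        using has_derivative_linear[OF vD] bounded_linear.linear[OF r]
        by (simp only: linear_add linear_scale real_scaleR_def)
      finally show ?thesis by (simp add: rs rt)
    qed
    moreover have "((\<lambda>z. r (v z)) has_derivative (\<lambda>k. r (Dv z k))) (at z)"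
      by (rule bounded_linear.has_derivative[OF r vD])
    ultimately show "((\<lambda>z. r (v z)) has_derivative (\<lambda>k. P z * Re k + Q z * Im k)) (at z)" by simp
    let ?D2 = "\<lambda>w. frechet_derivative (\<lambda>x. Dv x w) (at z)"
    have vD2: "((\<lambda>x. Dv x w) has_derivative ?D2 w) (at z)" for w
      using twice_differentiable_onD(3)[OF v z] frechet_derivative_works by (auto simp: Dv_def)
    \<comment> \<open>Makes the terms with second derivatives of \<open>v\<close> cancel in
      \<open>?P' 1 + ?Q' \<i>\<close>.\<close>
    have sym: "?D2 \<i> 1 = ?D2 1 \<i>"
      using second_derivative_symmetric[OF v V z] by (simp add: Dv_def)
    have hD: "(h has_derivative frechet_derivative h (at (v z))) (at (v z))"
      using h[OF vO] frechet_derivative_works by blast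
    let ?T = "\<lambda>w. frechet_derivative (\<lambda>y. \<theta> y w) (at (v z))"
    let ?P' = "\<lambda>k. (\<theta> (v z) (?D2 \<i> k) + ?T (Dv z \<i>) (Dv z k)) - c * frechet_derivative h (at (v z)) (Dv z k)"
    let ?Q' = "\<lambda>k. - (\<theta> (v z) (?D2 1 k) + ?T (Dv z 1) (Dv z k))"
    have "(P has_derivative ?P') (at z)"
      unfolding P_def
      by (intro has_derivative_diff has_derivative_mult_right has_derivative_compose[OF vD hD]
          has_derivative_linear_field[OF G(1) vO lin \<theta>[OF vO] vD vD2])
    moreover have "(Q has_derivative ?Q') (at z)"
      unfolding Q_def
      by (intro has_derivative_minus has_derivative_linear_field[OF G(1) vO lin \<theta>[OF vO] vD vD2])
    moreover have "?P' 1 + ?Q' \<i> \<ge> 0"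
    proof -
      \<comment> \<open>Merges \<open>Dv z \<i>\<close> and \<open>Z z\<close> into the one argument
        \<open>Dv z \<i> - c *\<^sub>R Z z\<close>, which \<open>Js\<close> identifies with
        \<open>J z (Dv z 1)\<close>.\<close>
      have lin2: "d\<theta> (v z) a (b - c *\<^sub>R b') = d\<theta> (v z) a b - c * d\<theta> (v z) a b'" for a b b'
      proof -
        have "((\<lambda>y. \<theta> y b - c * \<theta> y b') has_derivative (\<lambda>k. ?T b k - c * ?T b' k)) (at (v z))"
          using \<theta>[OF vO] frechet_derivative_works
          by (intro has_derivative_diff has_derivative_mult_right) blast+
        then have "((\<lambda>y. \<theta> y (b - c *\<^sub>R b')) has_derivative (\<lambda>k. ?T b k - c * ?T b' k)) (at (v z))"
          by (rule has_derivative_transform_within_open[OF _ G(1) vO])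
            (use lin in \<open>simp add: linear_diff linear_scale\<close>)
        then have "?T (b - c *\<^sub>R b') = (\<lambda>k. ?T b k - c * ?T b' k)"
          using frechet_derivative_at by metis
        then show ?thesis
          unfolding d\<theta>_def
          using linear_frechet_derivative[OF \<theta>[OF vO, of a]]
          by (simp add: linear_diff linear_scale algebra_simps)
      qed
      have "?P' 1 + ?Q' \<i> = d\<theta> (v z) (Dv z 1) (Dv z \<i>) - c * d\<theta> (v z) (Dv z 1) (Z z)"
        using Z[OF z, of "Dv z 1"] unfolding d\<theta>_def sym by simp
      also have "\<dots> = d\<theta> (v z) (Dv z 1) (J z (Dv z 1))"
        by (simp add: lin2 Js)
      finally show ?thesis using tame[OF z] by simp
    qed
    ultimately show "\<exists>P' Q'. (P has_derivative P') (at z) \<and> (Q has_derivative Q') (at z) \<and> P' 1 + Q' \<i> \<ge> 0"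
      by blast
  qed
  then show ?thesis unfolding C2_subharmonic_on_def by blast
qed


section \<open>Passage to charts\<close>

lemma topological_chartD:
  assumes "topological_chart V \<psi>"
  shows "open V" "open (\<psi> ` V)" "inj_on \<psi> V" "continuous_on V \<psi>"
    "\<And>x. x \<in> \<psi> ` V \<Longrightarrow> inv_into V \<psi> x \<in> V \<and> \<psi> (inv_into V \<psi> x) = x"
    "\<And>p. p \<in> V \<Longrightarrow> inv_into V \<psi> (\<psi> p) = p"
  using assms unfolding topological_chart_def homeomorphism_def
  by (auto simp: inj_on_def inv_into_into f_inv_into_f) metis

lemma topological_chart_open_image:
  assumes "topological_chart V \<psi>" "open U" "U \<subseteq> V"
  shows "open (\<psi> ` U)"
proof -
  have h: "homeomorphism V (\<psi> ` V) \<psi> (inv_into V \<psi>)" and "open (\<psi> ` V)"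
    using assms(1) by (auto simp: topological_chart_def)
  have "openin (top_of_set V) U" using assms by (simp add: openin_open_eq topological_chart_def)
  then show ?thesis
    using homeomorphism_imp_open_map[OF h] openin_open_trans \<open>open (\<psi> ` V)\<close> by blast
qed

lemma topological_chart_open_preimage:
  assumes "topological_chart V \<psi>" "open N"
  shows "open (V \<inter> \<psi> -` N)"
  using assms topological_chartD(1,4) continuous_open_preimage by blast

text \<open>Keeps the topological content of a chart, so that the same facts serve the smooth
  atlases and the holomorphic atlas of the domain.\<close>

definition atlas_chart :: "('i, 'm::topological_space, 'e::euclidean_space) atlas \<Rightarrow> 'i \<Rightarrow> bool" where
  "atlas_chart A i \<longleftrightarrow> topological_chart (dom_of A i) (crd A i)"

lemma atlas_chartD: "atlas_chart A i \<Longrightarrow> topological_chart (dom_of A i) (crd A i)"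
  unfolding atlas_chart_def .

lemma smooth_atlas_chart: "smooth_atlas A \<Longrightarrow> atlas_chart A i"
  unfolding atlas_chart_def smooth_atlas_def smooth_chart_def by blast

lemma smooth_atlas_covers: "smooth_atlas A \<Longrightarrow> \<exists>i. p \<in> dom_of A i"
  unfolding smooth_atlas_def by blast

lemma par_crd:
  "atlas_chart A i \<Longrightarrow> p \<in> dom_of A i \<Longrightarrow> par A i (crd A i p) = p"
  unfolding par_def atlas_chart_def by (rule topological_chartD(6))

text \<open>At a boundary point of \<open>S\<close> the map can only be differentiated in all
  directions after extending its coordinate expression to an open set. Shrinking \<open>N\<close> by
  continuity keeps \<open>F q\<close> in the chart \<open>j\<close>, so \<open>g\<close> represents
  \<open>F\<close> at all nearby points of \<open>S\<close>.\<close>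

lemma smooth_map_local_extension:
  assumes A: "atlas_chart A i" and B: "open (dom_of B j)"
    and F: "smooth_map A B S F" and p: "p \<in> S" "p \<in> dom_of A i" "F p \<in> dom_of B j"
  obtains N g where "open N" "crd A i p \<in> N" "twice_differentiable_on N g"
    "\<And>q. q \<in> S \<inter> dom_of A i \<Longrightarrow> crd A i q \<in> N \<Longrightarrow> F q \<in> dom_of B j \<and> g (crd A i q) = crd B j (F q)"
proof -
  have "continuous_on S F" using F by (simp add: smooth_map_def)
  then obtain T where T: "open T" "T \<inter> S = F -` dom_of B j \<inter> S"
    using B continuous_on_open_invariant by metis
  let ?S = "crd A i ` (dom_of A i \<inter> S \<inter> F -` dom_of B j)"
  have "smooth_on ?S (\<lambda>x. crd B j (F (par A i x)))" using F by (simp add: smooth_map_def)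
  then obtain M g where M: "open M" "crd A i p \<in> M" "\<And>k. Ck_on k M g"
    "\<And>y. y \<in> M \<inter> ?S \<Longrightarrow> g y = crd B j (F (par A i y))"
    using p unfolding smooth_on_def by (metis (no_types, lifting) IntI imageI vimageI)
  have open': "open (crd A i ` (dom_of A i \<inter> T))"
    by (rule topological_chart_open_image[OF atlas_chartD[OF A]]) (use topological_chartD(1)[OF atlas_chartD[OF A]] T in auto)
  show ?thesis
  proof
    show "open (M \<inter> crd A i ` (dom_of A i \<inter> T))" using open' M by blast
    show "crd A i p \<in> M \<inter> crd A i ` (dom_of A i \<inter> T)" using M T p by blast
    show "twice_differentiable_on (M \<inter> crd A i ` (dom_of A i \<inter> T)) g"
      using Ck_on_2_imp_twice_differentiable_on[OF M(3)] twice_differentiable_on_subset by blast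
    fix q assume q: "q \<in> S \<inter> dom_of A i" "crd A i q \<in> M \<inter> crd A i ` (dom_of A i \<inter> T)"
    then have "q \<in> T" using topological_chartD(3)[OF atlas_chartD[OF A]] by (auto simp: inj_on_def)
    then have "F q \<in> dom_of B j" using q T by blast
    moreover have "g (crd A i q) = crd B j (F q)"
      using M(4)[of "crd A i q"] q \<open>F q \<in> dom_of B j\<close> par_crd[OF A, of q] by auto
    ultimately show "F q \<in> dom_of B j \<and> g (crd A i q) = crd B j (F q)" ..
  qed
qed

text \<open>\<open>has_differential\<close> is a derivative within the image of \<open>S\<close>,
  where \<open>g\<close> and the coordinate expression of \<open>F\<close> agree, so the full
  derivative of the extension qualifies.\<close>

lemma has_differential_local_extension:
  assumes A: "atlas_chart A i"
    and N: "open N" "crd A i p \<in> N" and p: "p \<in> S" "p \<in> dom_of A i"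
    and g: "(g has_derivative D) (at (crd A i p))"
    and eq: "\<And>q. q \<in> S \<inter> dom_of A i \<Longrightarrow> crd A i q \<in> N \<Longrightarrow> g (crd A i q) = crd B j (F q)"
  shows "has_differential A B S F i j p D"
proof -
  obtain d where d: "d > 0" "ball (crd A i p) d \<subseteq> N" using N open_contains_ball by blast
  show ?thesis
    unfolding has_differential_def
  proof (rule has_derivative_transform_within[OF has_derivative_at_withinI[OF g] d(1)])
    show "crd A i p \<in> crd A i ` (dom_of A i \<inter> S)" using p by blast
    fix x assume "x \<in> crd A i ` (dom_of A i \<inter> S)" "dist x (crd A i p) < d"
    then show "g x = crd B j (F (par A i x))"
      using eq d(2) par_crd[OF A] by (auto simp: dist_commute subset_iff)
  qed
qed

section \<open>Product charts of the symplectization\<close>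

lemma par_times_vec:
  assumes B: "atlas_chart B j" and x: "x \<in> crd B j ` dom_of B j"
  shows "par (times_vec B) j (x, R) = (par B j x, R)"
proof -
  obtain q where q: "q \<in> dom_of B j" "x = crd B j q" using x by blast
  have "inj_on (map_prod (crd B j) id) (dom_of B j \<times> UNIV)"
    using topological_chartD(3)[OF atlas_chartD[OF B]] by (intro map_prod_inj_on) auto
  then have "inv_into (dom_of B j \<times> UNIV) (map_prod (crd B j) id) (map_prod (crd B j) id (q, R)) = (q, R)"
    using q by (intro inv_into_f_f) auto
  then have "par (times_vec B) j (crd B j q, R) = (q, R)"
    unfolding par_def by (simp add: times_vec_def)
  then show ?thesis using q par_crd[OF B] by simp
qed

text \<open>The coefficients of \<open>R\<alpha>\<close> and the Hamiltonian \<open>fR\<close> both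
  have the form \<open>F * R\<close>, so one product rule serves both.
  \<open>par (times_vec B) j\<close> splits into components on the image of the chart; as this is
  open, the derivatives agree.\<close>

lemma coord_deriv_times_vec:
  fixes F :: "'q::topological_space \<Rightarrow> real" and B :: "('j, 'q, 'f::euclidean_space) atlas"
  assumes B: "atlas_chart B j" and q: "q \<in> dom_of B j"
    and F: "(\<lambda>x. F (par B j x)) differentiable at (crd B j q)"
  shows "(\<lambda>y. F (par B j (fst y)) * snd y) differentiable at (crd B j q, R)" (is ?diff)
    and "frechet_derivative (\<lambda>y. F (par B j (fst y)) * snd y) (at (crd B j q, R)) =
      coord_deriv (times_vec B) j (\<lambda>b. F (fst b) * snd b) (q, R)" (is ?eq)
    and "coord_deriv (times_vec B) j (\<lambda>b. F (fst b) * snd b) (q, R) v =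
      coord_deriv B j F q (fst v) * R + F q * snd v"
proof -
  let ?G = "crd B j ` dom_of B j \<times> (UNIV :: real set)"
  have FD: "((\<lambda>x. F (par B j x)) has_derivative coord_deriv B j F q) (at (fst (crd B j q, R)))"
    using F frechet_derivative_works unfolding coord_deriv_def by fastforce
  have fstD: "(fst has_derivative fst) (at (crd B j q, R))" and sndD: "(snd has_derivative snd) (at (crd B j q, R))"
    by (auto intro: derivative_eq_intros)
  have D: "((\<lambda>y. F (par B j (fst y)) * snd y) has_derivative
      (\<lambda>k. F (par B j (fst (crd B j q, R))) * snd k + coord_deriv B j F q (fst k) * snd (crd B j q, R)))
      (at (crd B j q, R))"
    by (rule has_derivative_mult[OF has_derivative_compose[OF fstD FD] sndD])
  then show diff: ?diff unfolding differentiable_def by blast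
  have G: "open ?G" using topological_chartD(2)[OF atlas_chartD[OF B]] by (simp add: open_Times)
  have eq: "F (par B j (fst y)) * snd y = F (fst (par (times_vec B) j y)) * snd (par (times_vec B) j y)"
    if "y \<in> ?G" for y
    using that par_times_vec[OF B, of "fst y" "snd y"] by (simp add: mem_Times_iff)
  show eq': ?eq
    unfolding coord_deriv_def
    using frechet_derivative_transform_within_open[OF diff G _ eq] q by (simp add: times_vec_def)
  show "coord_deriv (times_vec B) j (\<lambda>b. F (fst b) * snd b) (q, R) v =
      coord_deriv B j F q (fst v) * R + F q * snd v"
    unfolding eq'[symmetric] frechet_derivative_at[OF D, symmetric] using par_crd[OF B q] by simp
qed

lemma smooth_components_differentiable:
  assumes "atlas_chart B j" "smooth_components B UNIV T" "q \<in> dom_of B j"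
  shows "(\<lambda>x. T j (par B j x)) differentiable at (crd B j q)"
proof -
  have "smooth_on (crd B j ` dom_of B j) (\<lambda>x. T j (par B j x))"
    using assms(2) by (simp add: smooth_components_def)
  from smooth_on_imp_twice_differentiable_on[OF this topological_chartD(2)[OF atlas_chartD[OF assms(1)]]]
  show ?thesis using assms(3) twice_differentiable_onD(1) by blast
qed

lemma smooth_fun_differentiable:
  assumes "atlas_chart B j" "smooth_fun B UNIV h" "q \<in> dom_of B j"
  shows "(\<lambda>x. h (par B j x)) differentiable at (crd B j q)"
  using smooth_components_differentiable[OF assms(1) _ assms(3), where T = "\<lambda>_. h"] assms(2)
  by (simp add: smooth_components_def smooth_fun_def)

text \<open>Differentiate the constant function \<open>h (\<Phi> s q)\<close> at
  \<open>s = 0\<close> by the chain rule in the chart \<open>j\<close>.\<close>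

lemma flow_invariant_imp_derivative_zero:
  fixes h :: "'q::topological_space \<Rightarrow> real"
  assumes B: "atlas_chart B j" and h: "smooth_fun B UNIV h"
    and flow: "flow_of B Y \<Phi>" and inv: "\<And>t x. h (\<Phi> t x) = h x" and q: "q \<in> dom_of B j"
  shows "coord_deriv B j h q (Y j q) = 0"
proof -
  have 0: "\<Phi> 0 q = q" and cont: "continuous_on UNIV (\<lambda>t. \<Phi> t q)"
    using flow by (auto simp: flow_of_def)
  have "((\<lambda>s. crd B j (\<Phi> s q)) has_vector_derivative Y j (\<Phi> 0 q)) (at 0)"
    using flow q 0 unfolding flow_of_def by metis
  then have c: "((\<lambda>s. crd B j (\<Phi> s q)) has_derivative (\<lambda>s. s *\<^sub>R Y j q)) (at 0)"
    by (simp add: has_vector_derivative_def 0)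
  have "((\<lambda>x. h (par B j x)) has_derivative coord_deriv B j h q) (at (crd B j q))"
    using smooth_fun_differentiable[OF B h q] frechet_derivative_works
    unfolding coord_deriv_def by fastforce
  then have "((\<lambda>x. h (par B j x)) has_derivative coord_deriv B j h q) (at (crd B j (\<Phi> 0 q)))"
    by (simp add: 0)
  from has_derivative_compose[OF c this]
  have D: "((\<lambda>s. h (par B j (crd B j (\<Phi> s q)))) has_derivative (\<lambda>s. coord_deriv B j h q (s *\<^sub>R Y j q))) (at 0)" .
  \<comment> \<open>For small times the flow line stays in the chart, where \<open>par B j\<close>
    undoes \<open>crd B j\<close>.\<close>
  have "open ((\<lambda>t. \<Phi> t q) -` dom_of B j)"
    using open_vimage[OF topological_chartD(1)[OF atlas_chartD[OF B]] cont] .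
  from has_derivative_transform_within_open[OF D this]
  have "((\<lambda>s. h q) has_derivative (\<lambda>s. coord_deriv B j h q (s *\<^sub>R Y j q))) (at 0)"
    using q 0 inv par_crd[OF B] by simp
  then have "(\<lambda>s. coord_deriv B j h q (s *\<^sub>R Y j q)) = (\<lambda>s. 0)"
    using has_derivative_unique has_derivative_const by blast
  then show ?thesis by (metis scaleR_one)
qed

section \<open>Solutions in holomorphic coordinates\<close>

text \<open>Complex linearity gives \<open>D \<i> = I (D 1)\<close>; applying \<open>I\<close> once
  more yields Floer's equation with zero vector field. Charts of \<open>C\<close> itself serve as
  the coordinates.\<close>

lemma pseudoholomorphic_curve_imp_floer_solution:
  assumes C: "riemann_surface C" and A: "smooth_atlas A" and I: "almost_complex_structure A UNIV I"
    and u: "pseudoholomorphic_curve C A I u"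
  shows "floer_solution C A I (\<lambda>_ _ _. 0) u"
  unfolding floer_solution_def
proof (intro conjI allI)
  show uS: "smooth_map C A UNIV u"
    using u by (simp add: pseudoholomorphic_curve_def pseudoholomorphic_map_def)
  fix z0
  obtain k where k: "z0 \<in> dom_of C k" "holomorphic_chart C (dom_of C k) (crd C k)"
    using C unfolding riemann_surface_def by blast
  then have Ck: "atlas_chart C k" by (simp add: holomorphic_chart_def atlas_chart_def)
  have "frechet_derivative (\<lambda>x. crd A i (u (par C k x))) (at (crd C k z)) 1 +
      I i (u z) (frechet_derivative (\<lambda>x. crd A i (u (par C k x))) (at (crd C k z)) \<i> - 0) = 0"
    if z: "z \<in> dom_of C k" and i: "u z \<in> dom_of A i" for z i
  proof -
    let ?u = "\<lambda>x. crd A i (u (par C k x))"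
    have Ai: "open (dom_of A i)" using topological_chartD(1)[OF atlas_chartD[OF smooth_atlas_chart[OF A]]] .
    have "open (u -` dom_of A i)" using uS Ai by (intro open_vimage) (auto simp: smooth_map_def)
    then have "open (crd C k ` (dom_of C k \<inter> u -` dom_of A i))"
      using topological_chartD(1)[OF atlas_chartD[OF Ck]] by (intro topological_chart_open_image[OF atlas_chartD[OF Ck]]) auto
    moreover have "smooth_on (crd C k ` (dom_of C k \<inter> u -` dom_of A i)) ?u"
      using uS by (auto simp: smooth_map_def)
    ultimately have "(?u has_derivative frechet_derivative ?u (at (crd C k z))) (at (crd C k z))"
      using z i by (intro twice_differentiable_onD(2)[OF smooth_on_imp_twice_differentiable_on]) auto
    then have "has_differential C A UNIV u k i z (frechet_derivative ?u (at (crd C k z)))"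
      unfolding has_differential_def by (rule has_derivative_at_withinI)
    then have "frechet_derivative ?u (at (crd C k z)) (\<i> * 1) = I i (u z) (frechet_derivative ?u (at (crd C k z)) 1)"
      using u z i unfolding pseudoholomorphic_curve_def pseudoholomorphic_map_def by blast
    then show ?thesis
      using I i by (simp add: almost_complex_structure_def)
  qed
  then show "\<exists>V \<zeta>. holomorphic_chart C V \<zeta> \<and> z0 \<in> V \<and>
        (\<forall>z\<in>V. \<forall>i. u z \<in> dom_of A i \<longrightarrow>
           (let D = frechet_derivative (\<lambda>x. crd A i (u (inv_into V \<zeta> x))) (at (\<zeta> z))
            in D 1 + I i (u z) (D \<i> - 0) = 0))"
    using k unfolding par_def Let_def by blast
qed

text \<open>The coordinate \<open>\<zeta>\<close> of Floer's equation need not belong to the atlas,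
  while smoothness of \<open>u\<close> is stated in charts of \<open>C\<close>; the holomorphic
  transition map links the two.\<close>

lemma twice_differentiable_in_holomorphic_chart:
  assumes C: "atlas_chart C k" and A: "open (dom_of A i)"
    and V: "holomorphic_chart C V \<zeta>" and u: "smooth_map C A UNIV u"
  shows "twice_differentiable_on (\<zeta> ` (V \<inter> dom_of C k \<inter> u -` dom_of A i))
    (\<lambda>x. crd A i (u (inv_into V \<zeta> x)))"
proof -
  let ?S = "V \<inter> dom_of C k \<inter> u -` dom_of A i"
  have V': "topological_chart V \<zeta>" using V by (simp add: holomorphic_chart_def)
  have ou: "open (u -` dom_of A i)" using u A by (intro open_vimage) (auto simp: smooth_map_def)
  have oS: "open (\<zeta> ` ?S)"
    using topological_chartD(1)[OF V'] topological_chartD(1)[OF atlas_chartD[OF C]] ou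
    by (intro topological_chart_open_image[OF V']) auto
  have oV: "open (\<zeta> ` (V \<inter> dom_of C k))"
    using topological_chartD(1)[OF V'] topological_chartD(1)[OF atlas_chartD[OF C]]
    by (intro topological_chart_open_image[OF V']) auto
  have "open (crd C k ` (dom_of C k \<inter> u -` dom_of A i))"
    using topological_chartD(1)[OF atlas_chartD[OF C]] ou by (intro topological_chart_open_image[OF atlas_chartD[OF C]]) auto
  moreover have "smooth_on (crd C k ` (dom_of C k \<inter> u -` dom_of A i)) (\<lambda>x. crd A i (u (par C k x)))"
    using u by (auto simp: smooth_map_def)
  ultimately have 1: "twice_differentiable_on (crd C k ` (dom_of C k \<inter> u -` dom_of A i)) (\<lambda>x. crd A i (u (par C k x)))"
    using smooth_on_imp_twice_differentiable_on by blast
  have "(\<lambda>x. crd C k (inv_into V \<zeta> x)) holomorphic_on \<zeta> ` (V \<inter> dom_of C k)"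
    using V by (simp add: holomorphic_chart_def)
  then have "twice_differentiable_on (\<zeta> ` (V \<inter> dom_of C k)) (\<lambda>x. crd C k (inv_into V \<zeta> x))"
    using oV by (rule holomorphic_imp_twice_differentiable_on)
  then have 2: "twice_differentiable_on (\<zeta> ` ?S) (\<lambda>x. crd C k (inv_into V \<zeta> x))"
    by (rule twice_differentiable_on_subset) auto
  have "twice_differentiable_on (\<zeta> ` ?S) (\<lambda>x. crd A i (u (par C k (crd C k (inv_into V \<zeta> x)))))"
    by (rule twice_differentiable_on_compose[OF 2 1 oS]) (use topological_chartD(6)[OF V'] in auto)
  then show ?thesis
    by (rule twice_differentiable_on_cong[OF _ oS]) (use topological_chartD(6)[OF V'] par_crd[OF C] in auto)
qed

section \<open>Geometry of the convex base\<close>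

context symplectic_Cstar_manifold_over_convex_base
begin

lemma base_chart: "atlas_chart B j"
  using smooth_atlas_chart[OF contact_manifold] .

lemma contact_coefficients_differentiable:
  assumes "q \<in> dom_of B j"
  shows "(\<lambda>x. \<alpha> j (par B j x) w) differentiable at (crd B j q)"
  using smooth_components_differentiable[OF base_chart _ assms, where T = "\<lambda>j p. \<alpha> j p w"] contact
  by (simp add: contact_form_def one_form_def)

lemma linear_contact: "q \<in> dom_of B j \<Longrightarrow> linear (\<alpha> j q)"
  using contact by (simp add: contact_form_def one_form_def)

lemma liouville_form_eq: "(\<lambda>b. liouville_form \<alpha> j b w) = (\<lambda>b. \<alpha> j (fst b) (fst w) * snd b)"
  by (simp add: liouville_form_def fun_eq_iff mult.commute)

text \<open>The Leibniz rule \<open>d(R\<alpha>) = R d\<alpha> + dR \<and> \<alpha>\<close>, where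
  \<open>snd\<close> is \<open>dR\<close> in product charts.\<close>

lemma symplectization_form_eq:
  assumes "q \<in> dom_of B j"
  shows "symplectization_form B \<alpha> j (q, R) v w =
    R * ext_deriv B \<alpha> j q (fst v) (fst w) + snd v * \<alpha> j q (fst w) - snd w * \<alpha> j q (fst v)"
  unfolding symplectization_form_def ext_deriv_def liouville_form_eq
    coord_deriv_times_vec(3)[OF base_chart assms contact_coefficients_differentiable[OF assms]]
  by (simp add: algebra_simps)

text \<open>The two identities say \<open>\<theta>(Z) = fR\<close> (pair with the Euler field \<open>R\<partial>\<^sub>R\<close>) and \<open>dR(Z) = 0\<close>
  (pair with the Reeb field).\<close>

lemma hamiltonian_field_of_fR:
  assumes Z: "hamiltonian_vector_field (times_vec B) (end_region R0) (symplectization_form B \<alpha>)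
      (\<lambda>(x, R). f x * R) Z"
    and b: "b \<in> end_region R0" "fst b \<in> dom_of B j"
  shows "\<alpha> j (fst b) (fst (Z j b)) = f (fst b)" "snd (Z j b) = 0"
proof -
  obtain q R where bq: "b = (q, R)" by (cases b)
  have q: "q \<in> dom_of B j" using b bq by simp
  have bd: "b \<in> dom_of (times_vec B) j" using q bq by (simp add: times_vec_def)
  have eq: "symplectization_form B \<alpha> j b v (Z j b) = coord_deriv B j f q (fst v) * R + f q * snd v" for v
  proof -
    have "symplectization_form B \<alpha> j b v (Z j b) = coord_deriv (times_vec B) j (\<lambda>b. f (fst b) * snd b) b v"
      using Z b(1) bd unfolding hamiltonian_vector_field_def case_prod_unfold by blast
    then show ?thesis
      unfolding bq
        coord_deriv_times_vec(3)[OF base_chart q smooth_fun_differentiable[OF base_chart f_smooth q]] .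
  qed
  have lin: "linear (coord_deriv B j f q)"
    unfolding coord_deriv_def
    using linear_frechet_derivative[OF smooth_fun_differentiable[OF base_chart f_smooth q]] .
  have "bilinear (symplectization_form B \<alpha> j b)"
    using base_symplectic b(1) bd by (simp add: symplectic_form_def bilinear_field_def)
  then have "symplectization_form B \<alpha> j b 0 (Z j b) = 0" by (rule bilinear_lzero)
  then have "R * ext_deriv B \<alpha> j q 0 (fst (Z j b)) = 0"
    using linear_0[OF linear_contact[OF q]] by (simp add: bq symplectization_form_eq[OF q])
  \<comment> \<open>Testing on \<open>(0, 1)\<close>, the coordinate field of \<open>R\<close>,
    isolates \<open>\<alpha>(Z)\<close> without a division by \<open>R\<close>.\<close>
  then show "\<alpha> j (fst b) (fst (Z j b)) = f (fst b)"
    using eq[of "(0, 1)"] linear_0[OF lin] linear_0[OF linear_contact[OF q]]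
    by (auto simp: bq symplectization_form_eq[OF q])
  obtain Y \<Phi> where Y: "reeb_field B \<alpha> Y" "flow_of B Y \<Phi>" "\<And>t x. f (\<Phi> t x) = f x"
    using f_invariant unfolding reeb_invariant_def by blast
  have "coord_deriv B j f q (Y j q) = 0"
    by (rule flow_invariant_imp_derivative_zero[OF base_chart f_smooth Y(2) _ q]) (rule Y(3))
  \<comment> \<open>On the Reeb vector \<open>(Y j q, 0)\<close> the \<open>d\<alpha>\<close> term
    vanishes and \<open>\<alpha>\<close> is 1, so the form leaves just
    \<open>- snd (Z j b)\<close>.\<close>
  then show "snd (Z j b) = 0"
    using eq[of "(Y j q, 0)"] Y(1) q by (simp add: bq symplectization_form_eq[OF q] reeb_field_def)
qed

section \<open>The maximum principle for Floer solutions\<close>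

text \<open>Near \<open>z0\<close> everything is written in three fixed charts:
  \<open>\<zeta>\<close> on the domain, \<open>i\<close> on \<open>Y\<close> and \<open>j\<close> on
  the contact manifold. The projected curve \<open>v\<close> then meets the hypotheses of
  \<open>floer_equation_imp_subharmonic\<close>.\<close>

lemma floer_solution_locally_subharmonic:
  assumes C: "riemann_surface C" and fl: "floer_solution C A I X u"
    and X: "\<And>z i p. p \<in> outer_part Yin \<inter> dom_of A i \<Longrightarrow> X z i p = c *\<^sub>R circle_field A \<phi> i p"
    and W: "open W" "W \<subseteq> u -` outer_part Yin" "z0 \<in> W"
  obtains V \<zeta> M where "topological_chart V \<zeta>" "open M" "z0 \<in> M" "M \<subseteq> V \<inter> W"
    "C2_subharmonic_on (\<zeta> ` M) (\<lambda>x. snd (\<Psi> (u (inv_into V \<zeta> x))))"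
proof -
  let ?B = "times_vec B"
  obtain Z where Z: "hamiltonian_vector_field ?B (end_region R0) (symplectization_form B \<alpha>) (\<lambda>(x, R). f x * R) Z"
    and push: "pushes_forward A ?B (outer_part Yin) \<Psi> (circle_field A \<phi>) Z"
    using Psi_pushes_forward by blast
  have u: "smooth_map C A UNIV u" using fl by (simp add: floer_solution_def)
  obtain V \<zeta> where V: "holomorphic_chart C V \<zeta>" "z0 \<in> V" and
    eqn: "\<And>z i. z \<in> V \<Longrightarrow> u z \<in> dom_of A i \<Longrightarrow>
      frechet_derivative (\<lambda>x. crd A i (u (inv_into V \<zeta> x))) (at (\<zeta> z)) 1 + I i (u z)
       (frechet_derivative (\<lambda>x. crd A i (u (inv_into V \<zeta> x))) (at (\<zeta> z)) \<i> - X z i (u z)) = 0"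
    using fl unfolding floer_solution_def Let_def by meson
  have V': "topological_chart V \<zeta>" using V(1) by (simp add: holomorphic_chart_def)
  obtain k where k: "z0 \<in> dom_of C k" using C unfolding riemann_surface_def by blast
  have Ck: "atlas_chart C k"
    using C by (simp add: riemann_surface_def holomorphic_chart_def atlas_chart_def)
  obtain i where i: "u z0 \<in> dom_of A i" using smooth_atlas_covers[OF manifold] by blast
  have Ai: "atlas_chart A i" using smooth_atlas_chart[OF manifold] .
  obtain j where j: "fst (\<Psi> (u z0)) \<in> dom_of B j" using smooth_atlas_covers[OF contact_manifold] by blast
  have domB: "dom_of ?B j = dom_of B j \<times> UNIV" and crdB: "crd ?B j b = (crd B j (fst b), snd b)" for b
    by (auto simp: times_vec_def map_prod_def case_prod_unfold)
  have oB: "open (dom_of ?B j)"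
    unfolding domB using topological_chartD(1)[OF atlas_chartD[OF base_chart]] by (simp add: open_Times)
  have Psi: "smooth_map A ?B (outer_part Yin) \<Psi>"
    using Psi_pseudoholomorphic by (simp add: pseudoholomorphic_map_def)
  have uz0: "u z0 \<in> outer_part Yin" using W by blast
  \<comment> \<open>The point \<open>u z0\<close> may lie on the boundary of the outer region, so
    \<open>\<Psi>\<close> is replaced by an extension \<open>g\<close> with full
    derivatives.\<close>
  obtain N g where N: "open N" "crd A i (u z0) \<in> N" "twice_differentiable_on N g"
    and g: "\<And>q. q \<in> outer_part Yin \<inter> dom_of A i \<Longrightarrow> crd A i q \<in> N \<Longrightarrow>
      \<Psi> q \<in> dom_of ?B j \<and> g (crd A i q) = crd ?B j (\<Psi> q)"
  proof (rule smooth_map_local_extension[OF Ai oB Psi uz0 i])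
    show "\<Psi> (u z0) \<in> dom_of ?B j" unfolding domB using j by (auto simp: mem_Times_iff)
  qed blast
  define M where "M = V \<inter> W \<inter> dom_of C k \<inter> u -` (dom_of A i \<inter> crd A i -` N)"
  have M: "open M" "z0 \<in> M" "M \<subseteq> V \<inter> W"
  proof -
    have "open (u -` (dom_of A i \<inter> crd A i -` N))"
      using u topological_chart_open_preimage[OF atlas_chartD[OF Ai] N(1)] by (intro open_vimage) (auto simp: smooth_map_def)
    then show "open M"
      unfolding M_def using W(1) topological_chartD(1)[OF V'] topological_chartD(1)[OF atlas_chartD[OF Ck]] by blast
    show "z0 \<in> M" "M \<subseteq> V \<inter> W" using V(2) W(3) k i N(2) by (auto simp: M_def)
  qed
  have oM: "open (\<zeta> ` M)" using topological_chart_open_image[OF V' M(1)] M(3) by blast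
  define U where "U x = crd A i (u (inv_into V \<zeta> x))" for x
  define v where "v x = crd ?B j (\<Psi> (u (inv_into V \<zeta> x)))" for x
  have inv: "inv_into V \<zeta> (\<zeta> z) = z" if "z \<in> M" for z using topological_chartD(6)[OF V'] M(3) that by blast
  have uM: "u z \<in> outer_part Yin" "u z \<in> dom_of A i" "crd A i (u z) \<in> N" if "z \<in> M" for z
    using that W(2) by (auto simp: M_def)
  have PsiM: "\<Psi> (u z) \<in> dom_of ?B j" "fst (\<Psi> (u z)) \<in> dom_of B j" "\<Psi> (u z) \<in> end_region R0"
    if "z \<in> M" for z
  proof -
    show "\<Psi> (u z) \<in> dom_of ?B j" using g[of "u z"] uM[OF that] by blast
    then show "fst (\<Psi> (u z)) \<in> dom_of B j" unfolding domB by (simp add: mem_Times_iff)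
    show "\<Psi> (u z) \<in> end_region R0" using Psi_maps uM(1)[OF that] by blast
  qed
  have vg: "v x = g (U x)" if "x \<in> \<zeta> ` M" for x
    using that inv g uM by (auto simp: v_def U_def)
  have U2: "twice_differentiable_on (\<zeta> ` M) U"
    unfolding U_def
    by (rule twice_differentiable_on_subset[OF twice_differentiable_in_holomorphic_chart[OF Ck
      topological_chartD(1)[OF atlas_chartD[OF Ai]] V(1) u]]) (auto simp: M_def)
  have UN: "U ` (\<zeta> ` M) \<subseteq> N" using inv uM by (auto simp: U_def)
  have v2: "twice_differentiable_on (\<zeta> ` M) v"
    by (rule twice_differentiable_on_cong[OF twice_differentiable_on_compose[OF U2 N(3) oM UN] oM vg])
  define Dg where "Dg z = frechet_derivative g (at (crd A i (u z)))" for z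
  define DU where "DU x = frechet_derivative U (at x)" for x
  have gD: "(g has_derivative Dg z) (at (crd A i (u z)))" if "z \<in> M" for z
    unfolding Dg_def using twice_differentiable_onD(2)[OF N(3) uM(3)[OF that]] .
  \<comment> \<open>The assumptions on \<open>\<Psi>\<close> range over all differentials relative
    to the outer region, so they apply to the derivative of the extension and give
    \<open>DgI\<close> and \<open>DgX\<close>.\<close>
  have diffl: "has_differential A ?B (outer_part Yin) \<Psi> i j (u z) (Dg z)" if "z \<in> M" for z
    by (rule has_differential_local_extension[OF Ai N(1) uM(3) uM(1,2) gD]) (use that g in auto)
  have DgI: "Dg z (I i (u z) w) = IB j (\<Psi> (u z)) (Dg z w)" if "z \<in> M" for z w
    using Psi_pseudoholomorphic diffl[OF that] uM[OF that] PsiM(1)[OF that]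
    unfolding pseudoholomorphic_map_def by blast
  have DgX: "Dg z (circle_field A \<phi> i (u z)) = Z j (\<Psi> (u z))" if "z \<in> M" for z
    using push diffl[OF that] uM[OF that] PsiM(1)[OF that] unfolding pushes_forward_def by blast
  have vD: "frechet_derivative v (at (\<zeta> z)) w = Dg z (DU (\<zeta> z) w)" if z: "z \<in> M" for z w
  proof -
    have "(U has_derivative DU (\<zeta> z)) (at (\<zeta> z))"
      unfolding DU_def using twice_differentiable_onD(2)[OF U2] z by blast
    moreover have "(g has_derivative Dg z) (at (U (\<zeta> z)))"
      using gD[OF z] inv[OF z] by (simp add: U_def)
    ultimately have "((\<lambda>x. g (U x)) has_derivative (\<lambda>w. Dg z (DU (\<zeta> z) w))) (at (\<zeta> z))"
      by (rule has_derivative_compose)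
    then have "(v has_derivative (\<lambda>w. Dg z (DU (\<zeta> z) w))) (at (\<zeta> z))"
      by (rule has_derivative_transform_within_open[OF _ oM]) (use z vg in auto)
    then show ?thesis using frechet_derivative_at by metis
  qed
  define \<theta> where "\<theta> y w = \<alpha> j (par B j (fst y)) (fst w) * snd y" for y w :: "'f \<times> real"
  define h where "h y = f (par B j (fst y)) * snd y" for y :: "'f \<times> real"
  let ?G = "crd B j ` dom_of B j \<times> (UNIV :: real set)"
  let ?inv = "inv_into V \<zeta>"
  have v_eq: "v (\<zeta> z) = (crd B j (fst (\<Psi> (u z))), snd (\<Psi> (u z)))" if "z \<in> M" for z
    using inv[OF that] by (simp add: v_def crdB)
  have par_v: "par B j (fst (v (\<zeta> z))) = fst (\<Psi> (u z))" if "z \<in> M" for z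
    using par_crd[OF base_chart PsiM(2)[OF that]] by (simp add: v_eq[OF that])
  have d\<theta>: "frechet_derivative (\<lambda>x. \<theta> x b) (at (v (\<zeta> z))) a - frechet_derivative (\<lambda>x. \<theta> x a) (at (v (\<zeta> z))) b
      = symplectization_form B \<alpha> j (\<Psi> (u z)) a b" if z: "z \<in> M" for z a b
    unfolding symplectization_form_def ext_deriv_def liouville_form_eq \<theta>_def v_eq[OF z]
    using coord_deriv_times_vec(2)[OF base_chart PsiM(2)[OF z] contact_coefficients_differentiable[OF PsiM(2)[OF z]],
        of _ "snd (\<Psi> (u z))"] by simp
  have linI: "linear (IB j (\<Psi> (u z)))" and IB2: "IB j (\<Psi> (u z)) (IB j (\<Psi> (u z)) w) = - w"
    and tame: "w \<noteq> 0 \<Longrightarrow> symplectization_form B \<alpha> j (\<Psi> (u z)) w (IB j (\<Psi> (u z)) w) > 0"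
    if z: "z \<in> M" for z w
    using base_compatible PsiM(1,3)[OF z]
    unfolding compatible_acs_def almost_complex_structure_def endo_field_def by blast+
  have bilin: "bilinear (symplectization_form B \<alpha> j (\<Psi> (u z)))" if z: "z \<in> M" for z
    using base_symplectic PsiM(1,3)[OF z] unfolding symplectic_form_def bilinear_field_def by blast
  have "C2_subharmonic_on (\<zeta> ` M) (\<lambda>x. snd (v x))"
  proof (rule floer_equation_imp_subharmonic[where \<theta> = \<theta> and h = h and c = c and G = ?G
        and J = "\<lambda>x. IB j (\<Psi> (u (?inv x)))" and Z = "\<lambda>x. Z j (\<Psi> (u (?inv x)))", OF oM v2])
    show "open ?G" using topological_chartD(2)[OF atlas_chartD[OF base_chart]] by (simp add: open_Times)
    show "v ` (\<zeta> ` M) \<subseteq> ?G" using v_eq PsiM(2) by auto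
    show "linear (\<theta> y)" if "y \<in> ?G" for y
    proof -
      have "linear (\<alpha> j (par B j (fst y)))"
        using that linear_contact par_crd[OF base_chart] by force
      then show ?thesis
        unfolding \<theta>_def by (intro linearI) (auto simp: linear_add linear_scale algebra_simps)
    qed
    show "(\<lambda>x. \<theta> x w) differentiable at y" if "y \<in> ?G" for y w
      using that coord_deriv_times_vec(1)[OF base_chart _ contact_coefficients_differentiable]
      unfolding \<theta>_def by force
    show "h differentiable at y" if "y \<in> ?G" for y
      using that coord_deriv_times_vec(1)[OF base_chart _ smooth_fun_differentiable[OF base_chart f_smooth]]
      unfolding h_def by force
    show "bounded_linear (snd :: 'f \<times> real \<Rightarrow> real)" by (rule bounded_linear_snd)
    fix x assume "x \<in> \<zeta> ` M"
    then obtain z where z: "z \<in> M" "x = \<zeta> z" by blast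
    note [simp] = z(2) inv[OF z(1)]
    show "linear (IB j (\<Psi> (u (?inv x))))" using linI[OF z(1)] by simp
    show "IB j (\<Psi> (u (?inv x))) (IB j (\<Psi> (u (?inv x))) w) = - w" for w using IB2[OF z(1)] by simp
    show "snd w = \<theta> (v x) (IB j (\<Psi> (u (?inv x))) w)" for w
    proof -
      have "snd w = liouville_form \<alpha> j (\<Psi> (u z)) (IB j (\<Psi> (u z)) w)"
        using base_contact_type PsiM(1,3)[OF z(1)] unfolding contact_type_def by blast
      then show ?thesis
        by (simp add: liouville_form_def \<theta>_def par_v[OF z(1)]) (simp add: v_eq[OF z(1)])
    qed
    \<comment> \<open>Compatibility gives strict positivity for nonzero \<open>w\<close>; at
      \<open>w = 0\<close> bilinearity gives the value 0.\<close>
    show "frechet_derivative (\<lambda>y. \<theta> y (IB j (\<Psi> (u (?inv x))) w)) (at (v x)) w -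
        frechet_derivative (\<lambda>y. \<theta> y w) (at (v x)) (IB j (\<Psi> (u (?inv x))) w) \<ge> 0" for w
      using tame[OF z(1), of w] bilinear_lzero[OF bilin[OF z(1)]] d\<theta>[OF z(1)]
      by (cases "w = 0") (auto intro: less_imp_le)
    show "frechet_derivative (\<lambda>y. \<theta> y (Z j (\<Psi> (u (?inv x))))) (at (v x)) w -
        frechet_derivative (\<lambda>y. \<theta> y w) (at (v x)) (Z j (\<Psi> (u (?inv x)))) =
        frechet_derivative h (at (v x)) w" for w
    proof -
      have "symplectization_form B \<alpha> j (\<Psi> (u z)) w (Z j (\<Psi> (u z))) =
          coord_deriv ?B j (\<lambda>b. f (fst b) * snd b) (\<Psi> (u z)) w"
        using Z PsiM(1,3)[OF z(1)] unfolding hamiltonian_vector_field_def case_prod_unfold by blast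
      also have "\<dots> = frechet_derivative h (at (v (\<zeta> z))) w"
        using coord_deriv_times_vec(2)[OF base_chart PsiM(2)[OF z(1)]
          smooth_fun_differentiable[OF base_chart f_smooth PsiM(2)[OF z(1)]], of "snd (\<Psi> (u z))"]
        unfolding h_def v_eq[OF z(1)] by simp
      finally show ?thesis using d\<theta>[OF z(1)] by simp
    qed
    show "\<theta> (v x) (Z j (\<Psi> (u (?inv x)))) = h (v x)"
      using hamiltonian_field_of_fR(1)[OF Z PsiM(3,2)[OF z(1)]]
      by (simp add: \<theta>_def h_def par_v[OF z(1)])
    show "snd (Z j (\<Psi> (u (?inv x)))) = 0"
      using hamiltonian_field_of_fR(2)[OF Z PsiM(3,2)[OF z(1)]] by simp
    show "frechet_derivative v (at x) 1 + IB j (\<Psi> (u (?inv x)))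
        (frechet_derivative v (at x) \<i> - c *\<^sub>R Z j (\<Psi> (u (?inv x)))) = 0"
    proof -
      have lin: "linear (Dg z)" using gD[OF z(1)] has_derivative_linear by blast
      have "z \<in> V" using M(3) z(1) by blast
      then have "DU x 1 + I i (u z) (DU x \<i> - c *\<^sub>R circle_field A \<phi> i (u z)) = 0"
        using eqn[of z i] uM[OF z(1)] X[of "u z" i z] by (simp add: DU_def U_def[abs_def])
      \<comment> \<open>The linear map \<open>Dg z\<close> carries Floer's equation to the base: it
        intertwines \<open>I\<close> with \<open>IB\<close> and sends the circle field to
        \<open>Z\<close>.\<close>
      then have "Dg z (DU x 1 + I i (u z) (DU x \<i> - c *\<^sub>R circle_field A \<phi> i (u z))) = 0"
        using linear_0[OF lin] by simp
      then show ?thesis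
        by (simp add: linear_add[OF lin] DgI[OF z(1)] linear_diff[OF lin] linear_scale[OF lin] DgX[OF z(1)] vD[OF z(1)])
    qed
  qed
  then have "C2_subharmonic_on (\<zeta> ` M) (\<lambda>x. snd (\<Psi> (u (inv_into V \<zeta> x))))"
    by (simp add: v_def crdB)
  then show ?thesis using that V' M by blast
qed

text \<open>The set \<open>E\<close> where the maximum over \<open>W\<close> is attained is closed
  by continuity and open by local subharmonicity, so it fills the connected set \<open>W\<close>.
  The real factor \<open>c\<close> is arbitrary, which covers both kinds of equation.\<close>

lemma floer_solution_maximum_principle:
  assumes C: "riemann_surface C" and fl: "floer_solution C A I X u"
    and X: "\<And>z i p. p \<in> outer_part Yin \<inter> dom_of A i \<Longrightarrow> X z i p = c *\<^sub>R circle_field A \<phi> i p"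
  shows "maximum_principle_on (u -` outer_part Yin) (\<lambda>z. snd (\<Psi> (u z)))"
  unfolding maximum_principle_on_def
proof (intro allI impI, elim conjE bexE)
  let ?\<rho> = "\<lambda>z. snd (\<Psi> (u z))"
  fix W z assume W: "open W" "connected W" "W \<subseteq> u -` outer_part Yin" and z: "z \<in> W" "\<forall>w\<in>W. ?\<rho> w \<le> ?\<rho> z"
  have cont: "continuous_on W ?\<rho>"
  proof -
    have "continuous_on (outer_part Yin) \<Psi>"
      using Psi_pseudoholomorphic by (simp add: pseudoholomorphic_map_def smooth_map_def)
    moreover have "continuous_on W u"
      using fl continuous_on_subset[of UNIV u W] by (simp add: floer_solution_def smooth_map_def)
    moreover have "u ` W \<subseteq> outer_part Yin" using W(3) by blast
    ultimately have "continuous_on W (\<lambda>z. \<Psi> (u z))"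
      by (rule continuous_on_compose2)
    then show ?thesis by (rule continuous_on_snd)
  qed
  define E where "E = {w \<in> W. ?\<rho> w = ?\<rho> z}"
  have "openin (top_of_set W) E"
  proof (subst openin_subopen, intro ballI)
    fix z0 assume z0: "z0 \<in> E"
    then obtain V \<zeta> M where V: "topological_chart V \<zeta>" and M: "open M" "z0 \<in> M" "M \<subseteq> V \<inter> W"
      and sub: "C2_subharmonic_on (\<zeta> ` M) (\<lambda>x. ?\<rho> (inv_into V \<zeta> x))"
      using floer_solution_locally_subharmonic[OF C fl X W(1,3), of z0] unfolding E_def by blast
    have inv: "inv_into V \<zeta> (\<zeta> w) = w" if "w \<in> M" for w
      using topological_chartD(6)[OF V] M(3) that by blast
    have "open (\<zeta> ` M)" using topological_chart_open_image[OF V M(1)] M(3) by blast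
    moreover have "?\<rho> (inv_into V \<zeta> x) \<le> ?\<rho> (inv_into V \<zeta> (\<zeta> z0))" if "x \<in> \<zeta> ` M" for x
      using that inv M z(2) z0 by (auto simp: E_def)
    ultimately obtain \<epsilon> where \<epsilon>: "\<epsilon> > 0"
      "\<And>x. x \<in> ball (\<zeta> z0) \<epsilon> \<Longrightarrow> ?\<rho> (inv_into V \<zeta> x) = ?\<rho> (inv_into V \<zeta> (\<zeta> z0))"
      using subharmonic_constant_near_max[OF _ _ sub] M(2) by blast
    define T where "T = M \<inter> (V \<inter> \<zeta> -` ball (\<zeta> z0) \<epsilon>)"
    have "open T" unfolding T_def using M(1) topological_chart_open_preimage[OF V] by auto
    moreover have "z0 \<in> T" using M \<epsilon>(1) by (auto simp: T_def)
    moreover have "T \<subseteq> E"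
      using \<epsilon>(2) inv M z0 by (fastforce simp: T_def E_def)
    moreover have "T \<subseteq> W" using M(3) by (auto simp: T_def)
    ultimately show "\<exists>T. openin (top_of_set W) T \<and> z0 \<in> T \<and> T \<subseteq> E"
      using W(1) openin_open_eq by blast
  qed
  moreover have "closedin (top_of_set W) E"
    unfolding E_def by (rule continuous_closedin_preimage_constant[OF cont])
  ultimately have "E = W"
    using W(2) z(1) unfolding connected_clopen E_def by blast
  then show "?\<rho> constant_on W" unfolding constant_on_def E_def by blast
qed

end

text \<open>Letting \<open>K\<close> and \<open>X\<close> depend on the domain point allows Floer
  data that vary over the interior of \<open>Yin\<close>, while \<open>X\<close> is one fixed
  multiple of the circle field on the outer region.\<close>

theorem proposition1p15:
  fixes A :: "('i, 'y::{t2_space, second_countable_topology}, 'e::euclidean_space) atlas"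
    and \<omega> :: "('i, 'y, 'e) form2"
    and I :: "('i, 'y, 'e) endo"
    and \<phi> :: "complex \<Rightarrow> 'y \<Rightarrow> 'y"
    and H :: "'y \<Rightarrow> real"
    and Yin :: "'y set"
    and B :: "('j, 'q::{t2_space, second_countable_topology}, 'f::euclidean_space) atlas"
    and \<alpha> :: "('j, 'q, 'f) form1"
    and R0 :: real
    and IB :: "('j, 'q \<times> real, 'f \<times> real) endo"
    and f :: "'q \<Rightarrow> real"
    and \<Psi> :: "'y \<Rightarrow> 'q \<times> real"
    and C :: "('k, 's::t2_space, complex) atlas"
  assumes "symplectic_Cstar_manifold_over_convex_base A \<omega> I \<phi> H Yin B \<alpha> R0 IB f \<Psi>"
    and "riemann_surface C"
  shows
    "(\<forall>u. pseudoholomorphic_curve C A I u \<longrightarrow>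
        maximum_principle_on (u -` outer_part Yin) (\<lambda>z. snd (\<Psi> (u z)))) \<and>
     (\<forall>(c::real) K X u.
        c > 0 \<and>
        (\<forall>z. smooth_fun A UNIV (K z) \<and> hamiltonian_vector_field A UNIV \<omega> (K z) (X z)) \<and>
        (\<forall>z i. \<forall>p \<in> outer_part Yin \<inter> dom_of A i. X z i p = c *\<^sub>R circle_field A \<phi> i p) \<and>
        floer_solution C A I X u \<longrightarrow>
        maximum_principle_on (u -` outer_part Yin) (\<lambda>z. snd (\<Psi> (u z))))"
proof -
  interpret symplectic_Cstar_manifold_over_convex_base A \<omega> I \<phi> H Yin B \<alpha> R0 IB f \<Psi>
    by (rule assms(1))
  have "maximum_principle_on (u -` outer_part Yin) (\<lambda>z. snd (\<Psi> (u z)))"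
    if "pseudoholomorphic_curve C A I u" for u
  proof -
    have "almost_complex_structure A UNIV I" using compatible by (simp add: compatible_acs_def)
    from pseudoholomorphic_curve_imp_floer_solution[OF assms(2) manifold this that]
    have "floer_solution C A I (\<lambda>_ _ _. 0) u" .
    \<comment> \<open>Pseudoholomorphic curves are the case \<open>c = 0\<close>.\<close>
    then show ?thesis
      by (rule floer_solution_maximum_principle[OF assms(2), where c = 0]) simp
  qed
  moreover have "maximum_principle_on (u -` outer_part Yin) (\<lambda>z. snd (\<Psi> (u z)))"
    if "\<forall>z i. \<forall>p \<in> outer_part Yin \<inter> dom_of A i. X z i p = c *\<^sub>R circle_field A \<phi> i p"
      "floer_solution C A I X u" for c X u
    by (rule floer_solution_maximum_principle[OF assms(2) that(2)]) (use that(1) in blast)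
  ultimately show ?thesis by blast
qed

end
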